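(* For the autonomous mechanical Lagrangian on $\mathbb{T}^2=\mathbb{R}^2/2\pi\mathbb{Z}^2$ given by $$L(x,\dot x)=\frac{\alpha(x_1)}{2}\|\dot x\|^2-V(x_1),\qquad V(x_1)=-\frac{2+\cos2x_1}{2+\sin x_1},\qquad \alpha(x_1)=2+\sin x_1,$$ where $\|\cdot\|$ is the Euclidean norm, there exists an E-L minimizer $\gamma:[a,b]\to\mathbb{R}^2$ which is not a Jacobi minimizer on its energy level, i.e. for its (constant) energy $E>V_{max}$.
   Context: $L$ is lifted to $T\mathbb{R}^2$, $V_{max}$ is the maximum of $V$, and the energy is $H(x,\dot x)=\frac{\alpha(x_1)}{2}\|\dot x\|^2+V(x_1)$, which is constant along solutions of the Euler-Lagrange (E-L) equations. Here $L$ is mechanical with respect to the Riemannian metric whose norm is $\|\dot x\|_g=\sqrt{\alpha(x_1)}\,\|\dot x\|$. E-L minimizer: a curve $\gamma:[a,b]\to\mathbb{R}^2$ such that for all absolutely continuous $\beta:[a,b]\to\mathbb{R}^2$ with $\beta(a)=\gamma(a)$ and $\beta(b)=\gamma(b)$, $\int_a^bL(\gamma,\dot\gamma)\,dt\le\int_a^bL(\beta,\dot\beta)\,dt$. Jacobi minimizer for energy $E$: a curve $\gamma:[a,b]\to\mathbb{R}^2$ such that for all absolutely continuous $\beta:[a_\beta,b_\beta]\to\mathbb{R}^2$ (on any interval) with $\beta(a_\beta)=\gamma(a)$ and $\beta(b_\beta)=\gamma(b)$, $\int_a^b\sqrt{E-V(\gamma)}\,\|\dot\gamma\|_g\,dt\le\int_{a_\beta}^{b_\beta}\sqrt{E-V(\beta)}\,\|\dot\beta\|_g\,dt$.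 *)

theory Defs
  imports "HOL-Analysis.Analysis"
begin

definition alpha :: "real \<Rightarrow> real" where
  "alpha s = 2 + sin s"

definition potential :: "real \<Rightarrow> real" where
  "potential s = - ((2 + cos (2 * s)) / (2 + sin s))"

definition potential_max :: real where
  "potential_max = (SUP s. potential s)"

definition lagrangian :: "real^2 \<Rightarrow> real^2 \<Rightarrow> real" where
  "lagrangian x v = alpha (x $ 1) / 2 * (norm v)\<^sup>2 - potential (x $ 1)"

definition energy :: "real^2 \<Rightarrow> real^2 \<Rightarrow> real" where
  "energy x v = alpha (x $ 1) / 2 * (norm v)\<^sup>2 + potential (x $ 1)"

definition gnorm :: "real^2 \<Rightarrow> real^2 \<Rightarrow> real" where
  "gnorm x v = sqrt (alpha (x $ 1)) * norm v"

(* Epsilon-delta absolute continuity. Each k in a division is a compact interval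
   [Inf k, Sup k], and distinct members have disjoint interiors. *)
definition absolutely_continuous_on ::
    "real set \<Rightarrow> (real \<Rightarrow> 'a::real_normed_vector) \<Rightarrow> bool" where
  "absolutely_continuous_on S f \<longleftrightarrow>
    (\<forall>\<epsilon>>0. \<exists>\<delta>>0. \<forall>D T. D division_of T \<and> T \<subseteq> S \<and> (\<Sum>k\<in>D. Sup k - Inf k) < \<delta> \<longrightarrow>
      (\<Sum>k\<in>D. norm (f (Sup k) - f (Inf k))) < \<epsilon>)"

(* The integral of F(c, c') over [a,b] as an extended real. The integrands used
   below are nonnegative (the Jacobi one for E >= potential_max), so for an absolutely continuous c the integrand is measurable and
   failure of integrability means that the integral is +infinity. An absolutely continuous c is
   differentiable almost everywhere, so the values of vector_derivative at points of
   non-differentiability do not matter. *)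
definition path_functional ::
    "(real^2 \<Rightarrow> real^2 \<Rightarrow> real) \<Rightarrow> real \<Rightarrow> real \<Rightarrow> (real \<Rightarrow> real^2) \<Rightarrow> ereal" where
  "path_functional F a b c =
    (if set_integrable lebesgue {a..b} (\<lambda>t. F (c t) (vector_derivative c (at t)))
     then ereal (LINT t:{a..b}|lebesgue. F (c t) (vector_derivative c (at t)))
     else \<infinity>)"

definition EL_minimizer :: "real \<Rightarrow> real \<Rightarrow> (real \<Rightarrow> real^2) \<Rightarrow> bool" where
  "EL_minimizer a b \<gamma> \<longleftrightarrow>
    (\<forall>\<beta>. absolutely_continuous_on {a..b} \<beta> \<and> \<beta> a = \<gamma> a \<and> \<beta> b = \<gamma> b \<longrightarrow>
      path_functional lagrangian a b \<gamma> \<le> path_functional lagrangian a b \<beta>)"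

definition jacobi_integrand :: "real \<Rightarrow> real^2 \<Rightarrow> real^2 \<Rightarrow> real" where
  "jacobi_integrand E x v = sqrt (E - potential (x $ 1)) * gnorm x v"

definition jacobi_minimizer :: "real \<Rightarrow> real \<Rightarrow> real \<Rightarrow> (real \<Rightarrow> real^2) \<Rightarrow> bool" where
  "jacobi_minimizer E a b \<gamma> \<longleftrightarrow>
    (\<forall>a' b' \<beta>. a' < b' \<and> absolutely_continuous_on {a'..b'} \<beta> \<and> \<beta> a' = \<gamma> a \<and> \<beta> b' = \<gamma> b \<longrightarrow>
      path_functional (jacobi_integrand E) a b \<gamma> \<le> path_functional (jacobi_integrand E) a' b' \<beta>)"

definition has_constant_energy :: "real \<Rightarrow> real \<Rightarrow> (real \<Rightarrow> real^2) \<Rightarrow> real \<Rightarrow> bool" where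
  "has_constant_energy a b \<gamma> E \<longleftrightarrow>
    (\<forall>t\<in>{a..b}. \<exists>v. (\<gamma> has_vector_derivative v) (at t within {a..b}) \<and> energy (\<gamma> t) v = E)"

(* The lagrangian descends to the torus: it is invariant under 2 pi Z^2. *)
lemma lagrangian_periodic:
  assumes "\<And>i. k $ i \<in> \<int>"
  shows "lagrangian (x + (2 * pi) *\<^sub>R k) v = lagrangian x v"
proof -
  obtain m where m: "k $ 1 = of_int m" using assms[of 1] by (auto elim: Ints_cases)
  have s: "sin (x $ 1 + 2 * pi * of_int m) = sin (x $ 1)"
    using cos_int_2pin[of m] sin_int_2pin[of m] by (simp add: sin_add)
  have "cos (2 * (x $ 1 + 2 * pi * of_int m)) = cos (2 * (x $ 1))"
    using s by (simp only: cos_double_sin)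
  with s m show ?thesis by (simp add: lagrangian_def alpha_def potential_def)
qed

lemma lagrangian_mechanical: "lagrangian x v = (gnorm x v)\<^sup>2 / 2 - potential (x $ 1)"
proof -
  have "0 \<le> alpha (x $ 1)" using sin_ge_minus_one[of "x $ 1"] unfolding alpha_def by linarith
  then show ?thesis by (simp add: lagrangian_def gnorm_def power_mult_distrib)
qed

(* The supremum defining potential_max is attained. *)
lemma potential_max_eq: "potential_max = potential (pi / 2)"
  unfolding potential_max_def
proof (rule cSup_eq_maximum)
  fix y assume "y \<in> range potential"
  then obtain s where y: "y = potential s" by auto
  let ?u = "sin s"
  have u: "-1 \<le> ?u" "?u \<le> 1" by auto
  have "0 \<le> (1 - ?u) * (7 + 6 * ?u)" using u by (intro mult_nonneg_nonneg) linarith+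
  then have "(2 + ?u) \<le> 3 * (3 - 2 * ?u\<^sup>2)" by (simp add: algebra_simps power2_eq_square)
  moreover have "0 < 2 + ?u" using u by linarith
  ultimately have "1 / 3 \<le> (3 - 2 * ?u\<^sup>2) / (2 + ?u)"
    by (subst pos_le_divide_eq) auto
  then show "y \<le> potential (pi / 2)" by (simp add: y potential_def cos_double_sin)
qed simp

end

theory Submission
  imports Defs
begin

text \<open>
  The example rests on the fact that the two notions of minimizer weigh a transition between the lines
  \<open>x\<^sub>1 = - pi / 2\<close> and \<open>x\<^sub>1 = pi / 2\<close> differently. For any \<open>\<omega>\<close>, completing the square gives
  \<open>L - \<omega> v\<^sub>2 = (\<alpha> / 2) v\<^sub>1\<^sup>2 + (\<alpha> / 2) (v\<^sub>2 - \<omega> / \<alpha>)\<^sup>2 + (2 + cos 2x\<^sub>1 - \<omega>\<^sup>2 / 2) / \<alpha>\<close>. If \<open>\<omega>\<^sup>2 = 2\<close>, the right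
  hand side vanishes for suitable uniform motions along both lines, with energy 0. Slightly below this
  energy, at \<open>E = - \<epsilon>\<close>, the line \<open>x\<^sub>1 = - pi / 2\<close> is longer in the Jacobi metric than the line
  \<open>x\<^sub>1 = pi / 2\<close>, by an amount of order \<open>\<epsilon>\<close> per unit length. A transition costs a constant, so
  after time of order \<open>1 / \<epsilon>\<close> a detour along the other line is shorter. With the time fixed, however, the action of the
  motion with energy \<open>- \<epsilon>\<close> along \<open>x\<^sub>1 = - pi / 2\<close> exceeds the lower bound from \<open>\<omega>\<^sup>2 = 2\<close> only by an
  amount of order \<open>\<epsilon>\<^sup>2\<close> per unit time, in total of order \<open>\<epsilon>\<close>, which does not pay for a transition. A
  competitor without transition is excluded by the calibration adapted to the energy \<open>- \<epsilon>\<close>. The numbers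
  below are \<open>\<epsilon> = 7 / 25\<close>, speed \<open>6 / 5\<close> and time 50: the Jacobi length of the motion is at least 48, that
  of the detour at most 40 (\<open>jacobi_length_uniform_path\<close>, \<open>jacobi_length_detour\<close>), while the motion is an
  Euler-Lagrange minimizer by \<open>EL_minimizer_uniform_path\<close>.

  The competitors are arbitrary absolutely continuous paths, so integrating the pointwise bounds on \<open>L\<close>
  (\<open>calibration\<close>) takes two facts: an absolutely continuous function is differentiable almost everywhere,
  and it is the integral of its derivative. The first holds because two Vitali covers of the set where
  the lower derivative is below \<open>p\<close> and the upper derivative above \<open>q > p\<close>, one by intervals of small slope
  and one by intervals of large slope, differ by little measure, hence by small increments
  (\<open>slope_gap_negligible\<close>, \<open>infinite_slope_negligible\<close>). The second follows directly from the definition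
  of the Henstock-Kurzweil integral (\<open>absolutely_continuous_has_integral\<close>).
\<close>

section \<open>Increments over divisions\<close>

text \<open>On the empty set both bounds are unspecified reals; the members of a division are nonempty, so
  the value there never enters.\<close>

definition increment :: "(real \<Rightarrow> 'a::real_normed_vector) \<Rightarrow> real set \<Rightarrow> 'a" where
  "increment f k = f (Sup k) - f (Inf k)"

lemma increment_Icc [simp]: "u \<le> v \<Longrightarrow> increment f {u..v} = f v - f u"
  by (simp add: increment_def)

lemma division_member_Icc:
  fixes D :: "real set set"
  assumes "D division_of T" "k \<in> D"
  obtains u v where "u \<le> v" "k = {u..v}"
proof -
  obtain u v where "k = cbox u v" using division_ofD(4)[OF assms] by auto
  moreover have "k \<noteq> {}" using division_ofD(3)[OF assms] .
  ultimately show thesis using that[of u v] by auto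
qed

lemma measure_Icc_increment:
  fixes D :: "real set set"
  assumes "D division_of T" "k \<in> D"
  shows "measure lebesgue k = increment id k"
proof -
  obtain u v where "u \<le> v" "k = {u..v}" using division_member_Icc[OF assms] by blast
  then show ?thesis by simp
qed

lemma sum_increment_id:
  fixes D :: "real set set"
  assumes "D division_of T"
  shows "(\<Sum>k\<in>D. increment id k) = measure lebesgue T"
  using content_division[OF assms] measure_Icc_increment[OF assms] by simp

lemma sum_increment_interval:
  fixes f :: "real \<Rightarrow> 'a::real_normed_vector"
  assumes "D division_of {a..b}" "a \<le> b"
  shows "(\<Sum>k\<in>D. increment f k) = f b - f a"
proof -
  let ?f = "(\<lambda>K::real set. if K = {} then 0 else f(interval_upperbound K) - f(interval_lowerbound K))"
  interpret operative_real plus 0 ?f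
    rewrites "comm_monoid_set.F (+) 0 = sum"
    by standard[1] (auto simp add: sum_def)
  have "sum ?f D = ?f (cbox a b)"
    using division[of D a b] assms by simp
  moreover have "?f k = increment f k" if "k \<in> D" for k
  proof -
    obtain u v where "u \<le> v" "k = {u..v}" using division_member_Icc[OF assms(1) \<open>k \<in> D\<close>] by blast
    then show ?thesis by simp
  qed
  then have "sum ?f D = (\<Sum>k\<in>D. increment f k)" by (rule sum.cong[OF refl])
  ultimately show ?thesis using assms(2) by simp
qed

text \<open>Exchanging a division of a set for a division of a subset costs only the increments over a
  remainder \<open>R\<close>. One \<open>R\<close> serves all functions at once: for the identity the equation says that the
  length of \<open>R\<close> is the measure of the difference, and this makes the increments of an absolutely
  continuous function over \<open>R\<close> small.

  The increments over two divisions of the same union of intervals are compared by completing both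
  divisions, with the same intervals \<open>P - I\<close>, to divisions of one large interval, where the sums
  telescope.\<close>

lemma division_remainder:
  fixes I J :: "real set set"
  assumes I: "I division_of S" and J: "J division_of T" and "T \<subseteq> S"
  obtains R where "R division_of \<Union>R" "\<Union>R \<subseteq> S"
    "\<And>f :: real \<Rightarrow> real. (\<Sum>k\<in>I. increment f k) = (\<Sum>k\<in>J. increment f k) + (\<Sum>k\<in>R. increment f k)"
proof -
  obtain r where r: "J \<subseteq> r" "r division_of S"
    using partial_division_extend[OF J I \<open>T \<subseteq> S\<close>] .
  obtain a b where ab: "S \<subseteq> cbox a b" using elementary_subset_cbox[OF I] by auto
  have S: "\<Union>I = S" using I by auto
  define a' b' where "a' = min a b" and "b' = max a b"
  have ab': "S \<subseteq> cbox a' b'" "a' \<le> b'" using ab by (auto simp: a'_def b'_def)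
  obtain P where P: "I \<subseteq> P" "P division_of cbox a' b'"
    using partial_division_extend_interval[of I a' b'] I ab' S by metis
  note Pd = division_ofD[OF P(2)]
  have PI: "(P - I) division_of \<Union>(P - I)"
    using division_of_subset[OF division_of_union_self[OF P(2)], of "P - I"] by auto
  have "interior S \<inter> interior k = {}" if "k \<in> P - I" for k
  proof -
    have "interior k \<inter> interior (\<Union>I) = {}"
    proof (rule Int_interior_Union_intervals)
      show "finite I" "\<And>T. T \<in> I \<Longrightarrow> \<exists>a b. T = cbox a b"
        using division_ofD[OF I] by auto
      show "interior k \<inter> interior T = {}" if "T \<in> I" for T
        using Pd(5)[of k T] P(1) \<open>k \<in> P - I\<close> that by blast
    qed auto
    then show ?thesis using S by blast
  qed
  then have "interior S \<inter> interior (\<Union>(P - I)) = {}"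
    by (intro Int_interior_Union_intervals) (use Pd in auto)
  then have "(r \<union> (P - I)) division_of (S \<union> \<Union>(P - I))"
    using division_disjoint_union[OF r(2) PI] by blast
  moreover have "S \<union> \<Union>(P - I) = cbox a' b'" using P S Pd(6) by blast
  ultimately have Q: "(r \<union> (P - I)) division_of {a'..b'}" by simp
  have fin: "finite r" "finite P" "finite I" using r P I by auto
  have "(\<Sum>k\<in>I. increment f k) = (\<Sum>k\<in>J. increment f k) + (\<Sum>k\<in>r - J. increment f k)"
    for f :: "real \<Rightarrow> real"
  proof -
    \<comment> \<open>Such a \<open>k\<close> lies in \<open>S\<close> and outside its interior, so it is a single point.\<close>
    have zero: "increment f k = 0" if "k \<in> r \<inter> (P - I)" for k
    proof -
      have k: "k \<in> r" "k \<in> P" "k \<notin> I" using that by auto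
      obtain u v where uv: "u \<le> v" "k = {u..v}" using division_member_Icc[OF r(2) k(1)] by blast
      have "k \<subseteq> S" using r(2) k by blast
      then have "interior k \<subseteq> interior S" by (rule interior_mono)
      moreover have "interior S \<inter> interior k = {}"
        using \<open>interior S \<inter> interior (\<Union>(P - I)) = {}\<close> interior_mono[of k "\<Union>(P - I)"] k by blast
      ultimately have "interior k = {}" by blast
      then have "u = v" using uv by auto
      then show ?thesis using uv by (auto simp: increment_def)
    qed
    have "(\<Sum>k\<in>r \<union> (P - I). increment f k) = (\<Sum>k\<in>P. increment f k)"
      using sum_increment_interval[OF Q ab'(2), of f] sum_increment_interval[of P a' b' f] P(2) ab'(2)
      by simp
    moreover have "(\<Sum>k\<in>P. increment f k) = (\<Sum>k\<in>P - I. increment f k) + (\<Sum>k\<in>I. increment f k)"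
      using P(1) fin by (simp add: sum.subset_diff)
    moreover have "(\<Sum>k\<in>r \<union> (P - I). increment f k) =
        (\<Sum>k\<in>r. increment f k) + (\<Sum>k\<in>P - I. increment f k)"
      using zero fin by (intro sum.union_inter_neutral) auto
    moreover have "(\<Sum>k\<in>r. increment f k) = (\<Sum>k\<in>r - J. increment f k) + (\<Sum>k\<in>J. increment f k)"
      using r(1) fin by (simp add: sum.subset_diff)
    ultimately show ?thesis by simp
  qed
  moreover have "(r - J) division_of \<Union>(r - J)"
    using division_of_subset[OF division_of_union_self[OF r(2)], of "r - J"] by auto
  moreover have "\<Union>(r - J) \<subseteq> S" using r(2) by auto
  ultimately show thesis using that by blast
qed

section \<open>Absolute continuity\<close>

lemma absolutely_continuous_onD:
  assumes "absolutely_continuous_on S f" "0 < \<epsilon>"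
  obtains \<delta> where "0 < \<delta>"
    "\<And>D T. \<lbrakk>D division_of T; T \<subseteq> S; (\<Sum>k\<in>D. increment id k) < \<delta>\<rbrakk>
       \<Longrightarrow> (\<Sum>k\<in>D. norm (increment f k)) < \<epsilon>"
  using assms unfolding absolutely_continuous_on_def increment_def id_def by metis

lemma absolutely_continuous_on_subset:
  "absolutely_continuous_on S f \<Longrightarrow> T \<subseteq> S \<Longrightarrow> absolutely_continuous_on T f"
  unfolding absolutely_continuous_on_def by (meson subset_trans)

lemma absolutely_continuous_on_lipschitz_comp:
  assumes ac: "absolutely_continuous_on S f"
    and lip: "\<And>s t. s \<in> S \<Longrightarrow> t \<in> S \<Longrightarrow> norm (g s - g t) \<le> C * norm (f s - f t)"
  shows "absolutely_continuous_on S g"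
  unfolding absolutely_continuous_on_def
proof (intro allI impI)
  fix \<epsilon> :: real assume "0 < \<epsilon>"
  define C' where "C' = max C 1"
  have C': "0 < C'" "C \<le> C'" by (auto simp: C'_def)
  obtain \<delta> where \<delta>: "0 < \<delta>" "\<And>D T. \<lbrakk>D division_of T; T \<subseteq> S; (\<Sum>k\<in>D. increment id k) < \<delta>\<rbrakk>
       \<Longrightarrow> (\<Sum>k\<in>D. norm (increment f k)) < \<epsilon> / C'"
    using absolutely_continuous_onD[OF ac, of "\<epsilon> / C'"] \<open>0 < \<epsilon>\<close> C' by auto
  have "(\<Sum>k\<in>D. norm (g (Sup k) - g (Inf k))) < \<epsilon>"
    if D: "D division_of T" "T \<subseteq> S" "(\<Sum>k\<in>D. Sup k - Inf k) < \<delta>" for D T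
  proof -
    have "norm (g (Sup k) - g (Inf k)) \<le> C' * norm (increment f k)" if "k \<in> D" for k
    proof -
      obtain u v where uv: "u \<le> v" "k = {u..v}" using division_member_Icc[OF D(1) \<open>k \<in> D\<close>] by blast
      have "k \<subseteq> S" using D that by blast
      then have "norm (g v - g u) \<le> C * norm (f v - f u)" using uv by (intro lip) auto
      also have "\<dots> \<le> C' * norm (f v - f u)" using C' by (intro mult_right_mono) auto
      finally show ?thesis using uv by simp
    qed
    then have "(\<Sum>k\<in>D. norm (g (Sup k) - g (Inf k))) \<le> C' * (\<Sum>k\<in>D. norm (increment f k))"
      by (simp add: sum_distrib_left sum_mono)
    also have "\<dots> < C' * (\<epsilon> / C')"
      using \<delta>(2)[OF D(1,2)] D(3) C' by (intro mult_strict_left_mono) (auto simp: increment_def)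
    finally show ?thesis using C' by simp
  qed
  then show "\<exists>\<delta>>0. \<forall>D T. D division_of T \<and> T \<subseteq> S \<and> (\<Sum>k\<in>D. Sup k - Inf k) < \<delta> \<longrightarrow>
      (\<Sum>k\<in>D. norm (g (Sup k) - g (Inf k))) < \<epsilon>"
    using \<delta>(1) by blast
qed

lemma absolutely_continuous_on_id: "absolutely_continuous_on S (\<lambda>t::real. t)"
  unfolding absolutely_continuous_on_def
proof (intro allI impI exI conjI; (elim conjE)?)
  fix \<epsilon> :: real and D T
  assume \<epsilon>: "0 < \<epsilon>" and D: "D division_of T" "(\<Sum>k\<in>D. Sup k - Inf k) < \<epsilon>"
  have "norm (Sup k - Inf k) = Sup k - Inf k" if "k \<in> D" for k
    using division_member_Icc[OF D(1) that] by fastforce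
  then show "(\<Sum>k\<in>D. norm (Sup k - Inf k)) < \<epsilon>" using D(2) by simp
qed

section \<open>Fine covers by intervals\<close>

lemma lmeasurable_open_superset:
  fixes B :: "'a::euclidean_space set"
  assumes "B \<in> lmeasurable" "0 < \<eta>"
  obtains U where "open U" "U \<in> lmeasurable" "B \<subseteq> U"
    "measure lebesgue U < measure lebesgue B + \<eta>"
proof -
  obtain U where U: "open U" "B \<subseteq> U" "U - B \<in> lmeasurable" "emeasure lebesgue (U - B) < ennreal \<eta>"
    using sets_lebesgue_outer_open[of B \<eta>] fmeasurableD[OF assms(1)] assms(2) by auto
  have Ueq: "U = B \<union> (U - B)" using U by blast
  have "U \<in> lmeasurable" using fmeasurable.Un[OF assms(1) U(3)] Ueq by simp
  moreover have "measure lebesgue U \<le> measure lebesgue B + measure lebesgue (U - B)"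
    using measure_Un_le[OF fmeasurableD[OF assms(1)] fmeasurableD[OF U(3)]] Ueq by simp
  moreover have "measure lebesgue (U - B) < \<eta>"
    using U(3,4) assms(2) by (simp add: emeasure_eq_measure2 ennreal_less_iff)
  ultimately show thesis using that U by simp
qed

text \<open>The sets of points of bad differentiability come without a proof of measurability. This lemma
  replaces their measure by the number \<open>m\<close>, their outer Lebesgue measure.\<close>

lemma positive_outer_measure:
  fixes A :: "'a::euclidean_space set"
  assumes "\<not> negligible A" "bounded A"
  obtains m where "0 < m" "\<And>B. B \<in> lmeasurable \<Longrightarrow> A \<subseteq> B \<Longrightarrow> m \<le> measure lebesgue B"
    "\<And>\<eta>. 0 < \<eta> \<Longrightarrow> \<exists>U. open U \<and> U \<in> lmeasurable \<and> A \<subseteq> U \<and> measure lebesgue U < m + \<eta>"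
proof -
  let ?X = "measure lebesgue ` {B \<in> lmeasurable. A \<subseteq> B}"
  define m where "m = Inf ?X"
  obtain c where "A \<subseteq> cbox (- c) c" using bounded_subset_cbox_symmetric[OF assms(2)] by blast
  then have ne: "?X \<noteq> {}" by blast
  have bdd: "bdd_below ?X" by (intro bdd_belowI[of _ 0]) auto
  have le: "m \<le> measure lebesgue B" if "B \<in> lmeasurable" "A \<subseteq> B" for B
    unfolding m_def using that bdd by (intro cInf_lower) auto
  have ex: "\<exists>B. B \<in> lmeasurable \<and> A \<subseteq> B \<and> measure lebesgue B < m + \<eta>" if "0 < \<eta>" for \<eta>
    using cInf_lessD[OF ne, of "m + \<eta>"] that by (auto simp: m_def)
  have "0 < m"
  proof (rule ccontr)
    assume "\<not> 0 < m"
    then have "\<exists>B. A \<subseteq> B \<and> B \<in> lmeasurable \<and> measure lebesgue B < e" if "0 < e" for e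
    proof -
      obtain B where "B \<in> lmeasurable" "A \<subseteq> B" "measure lebesgue B < m + e"
        using ex[OF \<open>0 < e\<close>] by blast
      moreover have "m + e \<le> e" using \<open>\<not> 0 < m\<close> by simp
      ultimately show ?thesis by (meson order_less_le_trans)
    qed
    then show False using assms(1) negligible_outer[of A] by metis
  qed
  moreover have "\<exists>U. open U \<and> U \<in> lmeasurable \<and> A \<subseteq> U \<and> measure lebesgue U < m + \<eta>"
    if "0 < \<eta>" for \<eta>
  proof -
    obtain B where B: "B \<in> lmeasurable" "A \<subseteq> B" "measure lebesgue B < m + \<eta> / 2"
      using ex[of "\<eta> / 2"] \<open>0 < \<eta>\<close> by auto
    obtain U where "open U" "U \<in> lmeasurable" "B \<subseteq> U"
        "measure lebesgue U < measure lebesgue B + \<eta> / 2"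
      by (rule lmeasurable_open_superset[OF B(1) half_gt_zero[OF \<open>0 < \<eta>\<close>]]) (rule that)
    with B show ?thesis by (intro exI[of _ U]) auto
  qed
  ultimately show thesis using le that by blast
qed

text \<open>Vitali's covering theorem, cut off after finitely many intervals: these miss at most \<open>\<eta>\<close> of the
  outer measure of \<open>A\<close>. Absolute continuity speaks of finite families only.\<close>

lemma finite_fine_cover:
  fixes A W :: "real set" and Q :: "real \<Rightarrow> real \<Rightarrow> bool"
  assumes W: "open W" "W \<in> lmeasurable" "A \<subseteq> W"
    and low: "\<And>B. B \<in> lmeasurable \<Longrightarrow> A \<subseteq> B \<Longrightarrow> m \<le> measure lebesgue B"
    and fine: "\<And>t d. t \<in> A \<Longrightarrow> 0 < d \<Longrightarrow> \<exists>u v. u < v \<and> u \<le> t \<and> t \<le> v \<and> v - u < d \<and> Q u v"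
    and "0 < \<eta>"
  obtains D where "D division_of \<Union>D" "\<Union>D \<subseteq> W" "m - \<eta> < measure lebesgue (\<Union>D)"
    "\<And>k. k \<in> D \<Longrightarrow> \<exists>u v. u < v \<and> k = {u..v} \<and> Q u v"
proof -
  define K where "K = {(u, v). u < v \<and> {u..v} \<subseteq> W \<and> Q u v}"
  define c where "c = (\<lambda>(u::real, v). (u + v) / 2)"
  define r where "r = (\<lambda>(u::real, v). (v - u) / 2)"
  have ball: "cball (c i) (r i) = {fst i..snd i}" for i
    by (cases i) (auto simp: c_def r_def cball_eq_atLeastAtMost field_simps)
  have rpos: "0 < r i" if "i \<in> K" for i using that by (auto simp: K_def r_def)
  have vit: "\<exists>i. i \<in> K \<and> x \<in> cball (c i) (r i) \<and> r i < d" if x: "x \<in> A" and d: "0 < d" for x d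
  proof -
    obtain e where e: "0 < e" "ball x e \<subseteq> W" using W x openE by blast
    obtain u v where uv: "u < v" "u \<le> x" "x \<le> v" "v - u < min d e" "Q u v"
      using fine[OF x, of "min d e"] d e by auto
    have "{u..v} \<subseteq> ball x e" using uv by (auto simp: dist_real_def)
    then have "(u, v) \<in> K" using uv e by (auto simp: K_def)
    moreover have "x \<in> cball (c (u, v)) (r (u, v))" using uv by (simp add: ball)
    moreover have "r (u, v) < d" using uv by (auto simp: r_def)
    ultimately show ?thesis by blast
  qed
  obtain C where C: "countable C" "C \<subseteq> K"
      "pairwise (\<lambda>i j. disjnt (cball (c i) (r i)) (cball (c j) (r j))) C"
      "negligible (A - (\<Union>i\<in>C. cball (c i) (r i)))"
    using Vitali_covering_theorem_cballs[of K r A c, OF rpos vit] by blast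
  define F where "F = (\<lambda>i. {fst i..snd i}) ` C"
  have FW: "k \<subseteq> W" and FQ: "\<exists>u v. u < v \<and> k = {u..v} \<and> Q u v" if "k \<in> F" for k
  proof -
    obtain u v where "(u, v) \<in> C" and k: "k = {u..v}" using \<open>k \<in> F\<close> by (auto simp: F_def)
    then have "(u, v) \<in> K" using C(2) by blast
    then show "k \<subseteq> W" "\<exists>u v. u < v \<and> k = {u..v} \<and> Q u v" using k by (auto simp: K_def)
  qed
  have neg: "negligible (A - \<Union>F)" using C(4) by (simp add: ball F_def)
  have disj: "k \<inter> l = {}" if kl: "k \<in> F" "l \<in> F" "k \<noteq> l" for k l
  proof -
    obtain i j where ij: "i \<in> C" "j \<in> C" "k = {fst i..snd i}" "l = {fst j..snd j}"
      using kl by (auto simp: F_def)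
    then show ?thesis using C(3) kl(3) by (auto simp: pairwise_def disjnt_def ball)
  qed
  have Fm: "k \<in> lmeasurable" if "k \<in> F" for k using FQ[OF that] by auto
  have cF: "countable F" using C(1) by (simp add: F_def)
  have FU: "\<Union>F \<in> lmeasurable"
  proof (rule fmeasurableI2[OF W(2)])
    show "\<Union>F \<subseteq> W" using FW by blast
    show "\<Union>F \<in> sets lebesgue" using cF Fm by (intro sets.countable_Union) auto
  qed
  have mF: "m \<le> measure lebesgue (\<Union>F)"
  proof -
    have "m \<le> measure lebesgue (\<Union>F \<union> (A - \<Union>F))"
      using low[of "\<Union>F \<union> (A - \<Union>F)"] FU negligible_imp_measurable[OF neg] by blast
    also have "\<dots> = measure lebesgue (\<Union>F)"
      using measure_Un_null_set[of "\<Union>F" lebesgue "A - \<Union>F"] FU neg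
      by (simp add: fmeasurableD negligible_iff_null_sets)
    finally show ?thesis .
  qed
  obtain D where D: "D \<subseteq> F" "finite D" "measure lebesgue (\<Union>F) - \<eta> < measure lebesgue (\<Union>D)"
  proof (rule measure_countable_Union_approachable[OF cF \<open>0 < \<eta>\<close> Fm])
    show "measure lebesgue (\<Union>D') \<le> measure lebesgue W" if "D' \<subseteq> F" "finite D'" for D'
    proof (rule measure_mono_fmeasurable[OF _ _ W(2)])
      show "\<Union>D' \<subseteq> W" using FW that by blast
      show "\<Union>D' \<in> sets lebesgue" using that Fm by (intro sets.finite_Union) auto
    qed
  qed auto
  have "D division_of \<Union>D"
  proof (rule division_ofI)
    fix k assume k: "k \<in> D"
    then obtain u v where "u < v" "k = {u..v}" using FQ D by blast
    then show "k \<noteq> {}" "\<exists>a b. k = cbox a b" by auto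
    show "k \<subseteq> \<Union>D" using k by blast
  next
    fix k l assume "k \<in> D" "l \<in> D" "k \<noteq> l"
    then have "k \<inter> l = {}" using disj D(1) by blast
    then show "interior k \<inter> interior l = {}" using interior_subset by blast
  qed (use D in auto)
  then show thesis using D FW FQ mF that[of D] by force
qed

section \<open>Differentiability of absolutely continuous functions\<close>

text \<open>The upper derivative at \<open>t\<close>, taken over intervals that contain \<open>t\<close>, is at least \<open>q\<close>, and arbitrarily
  small intervals around \<open>t\<close> witness it. Lower derivatives are treated by negating \<open>f\<close> and \<open>q\<close>.\<close>

definition exceeds_slope :: "(real \<Rightarrow> real) \<Rightarrow> real set \<Rightarrow> real \<Rightarrow> real \<Rightarrow> bool" where
  "exceeds_slope f S q t \<longleftrightarrow>
    (\<forall>d>0. \<exists>u v. u < v \<and> u \<le> t \<and> t \<le> v \<and> v - u < d \<and> {u..v} \<subseteq> S \<and> q * (v - u) < f v - f u)"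

text \<open>If the slopes at the points of a set of outer measure \<open>m > 0\<close> were unbounded, disjoint intervals of
  total length above \<open>m / 2\<close> and slope above \<open>2 / m\<close> would produce increments of total size above 1. In a
  ball so small that absolute continuity bounds the increments by 1 this is absurd.\<close>

lemma infinite_slope_negligible:
  assumes ac: "absolutely_continuous_on S f"
  shows "negligible {t. \<forall>K. exceeds_slope f S K t}" (is "negligible ?A")
proof (rule iffD2[OF locally_negligible_alt], rule ballI)
  fix x assume x: "x \<in> ?A"
  obtain \<delta> where \<delta>: "0 < \<delta>" "\<And>D T. \<lbrakk>D division_of T; T \<subseteq> S; (\<Sum>k\<in>D. increment id k) < \<delta>\<rbrakk>
       \<Longrightarrow> (\<Sum>k\<in>D. norm (increment f k)) < 1"
    by (rule absolutely_continuous_onD[OF ac zero_less_one]) (rule that)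
  let ?W = "ball x (\<delta> / 4)"
  have "negligible (?A \<inter> ?W)"
  proof (rule ccontr)
    assume *: "\<not> negligible (?A \<inter> ?W)"
    have "bounded (?A \<inter> ?W)" by (simp add: bounded_Int)
    obtain m where m: "0 < m"
      "\<And>B. B \<in> lmeasurable \<Longrightarrow> ?A \<inter> ?W \<subseteq> B \<Longrightarrow> m \<le> measure lebesgue B"
      by (rule positive_outer_measure[OF * \<open>bounded (?A \<inter> ?W)\<close>]) (rule that)
    have fine: "\<exists>u v. u < v \<and> u \<le> t \<and> t \<le> v \<and> v - u < d \<and> {u..v} \<subseteq> S \<and> 2 / m * (v - u) < f v - f u"
      if "t \<in> ?A \<inter> ?W" "0 < d" for t d
    proof -
      have "exceeds_slope f S (2 / m) t" using that by blast
      then show ?thesis using that(2) unfolding exceeds_slope_def by blast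
    qed
    obtain D where D: "D division_of \<Union>D" "\<Union>D \<subseteq> ?W" "m - m / 2 < measure lebesgue (\<Union>D)"
        "\<And>k. k \<in> D \<Longrightarrow> \<exists>u v. u < v \<and> k = {u..v} \<and> {u..v} \<subseteq> S \<and> 2 / m * (v - u) < f v - f u"
      by (rule finite_fine_cover[of ?W "?A \<inter> ?W" m, OF open_ball lmeasurable_ball Int_lower2
            m(2) fine half_gt_zero[OF m(1)]])
        (assumption | rule that)+
    have "measure lebesgue (\<Union>D) \<le> measure lebesgue ?W"
      using D(2) fmeasurableD[OF lmeasurable_division[OF D(1)]]
      by (intro measure_mono_fmeasurable) auto
    also have "\<dots> < \<delta>" using \<delta>(1) by (simp add: ball_eq_greaterThanLessThan)
    finally have "(\<Sum>k\<in>D. increment id k) < \<delta>" using sum_increment_id[OF D(1)] by simp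
    moreover have "\<Union>D \<subseteq> S" using D(4) by blast
    ultimately have "(\<Sum>k\<in>D. norm (increment f k)) < 1" using \<delta>(2) D(1) by blast
    moreover have "2 / m * increment id k \<le> norm (increment f k)" if "k \<in> D" for k
      using D(4)[OF that] by fastforce
    then have "(\<Sum>k\<in>D. 2 / m * increment id k) \<le> (\<Sum>k\<in>D. norm (increment f k))"
      by (rule sum_mono)
    ultimately have "2 / m * measure lebesgue (\<Union>D) < 1"
      using sum_increment_id[OF D(1)] sum_distrib_left[of "2 / m" "increment id" D]
      by (metis le_less_trans)
    then show False using D(3) m(1) by (simp add: field_simps)
  qed
  then show "\<exists>U. openin (top_of_set ?A) U \<and> x \<in> U \<and> negligible U"
    using x \<delta>(1) by (intro exI[of _ "?A \<inter> ?W"]) (auto intro: openin_open_Int)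
qed

text \<open>If the set had outer measure \<open>m > 0\<close>, it could be covered, up to errors of order \<open>\<eta>\<close>, once by
  intervals \<open>I\<close> of slope below \<open>p\<close> and then, inside these, by intervals \<open>J\<close> of slope above \<open>q\<close>. The two
  covers differ by a set of measure at most \<open>4 * \<eta>\<close>, so by absolute continuity the increments over
  them nearly agree, while they are at most about \<open>p * m\<close> and at least about \<open>q * m\<close>. The usual argument
  for monotone functions needs the increments over \<open>J\<close> to be bounded by those over \<open>I\<close>; absolute
  continuity takes the place of monotonicity.\<close>

lemma slope_gap_negligible:
  fixes f :: "real \<Rightarrow> real"
  assumes ac: "absolutely_continuous_on S f" and "bounded S" "p < q"
  shows "negligible {t. exceeds_slope (\<lambda>s. - f s) S (- p) t \<and> exceeds_slope f S q t}"
    (is "negligible ?A")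
proof (rule ccontr)
  assume *: "\<not> negligible ?A"
  have "t \<in> S" if "t \<in> ?A" for t
  proof -
    have "exceeds_slope f S q t" using that by blast
    then obtain u v where "u \<le> t" "t \<le> v" "{u..v} \<subseteq> S"
      using zero_less_one unfolding exceeds_slope_def by blast
    then show ?thesis by auto
  qed
  then have "?A \<subseteq> S" by blast
  then have "bounded ?A" by (rule bounded_subset[OF \<open>bounded S\<close>])
  obtain m where m: "0 < m"
      "\<And>B. B \<in> lmeasurable \<Longrightarrow> ?A \<subseteq> B \<Longrightarrow> m \<le> measure lebesgue B"
      "\<And>\<eta>. 0 < \<eta> \<Longrightarrow> \<exists>U. open U \<and> U \<in> lmeasurable \<and> ?A \<subseteq> U \<and> measure lebesgue U < m + \<eta>"
    by (rule positive_outer_measure[OF * \<open>bounded ?A\<close>]) (rule that)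
  define \<epsilon> where "\<epsilon> = (q - p) * m / 8"
  have "0 < \<epsilon>" using m \<open>p < q\<close> by (simp add: \<epsilon>_def)
  obtain \<delta> where \<delta>: "0 < \<delta>" "\<And>D T. \<lbrakk>D division_of T; T \<subseteq> S; (\<Sum>k\<in>D. increment id k) < \<delta>\<rbrakk>
       \<Longrightarrow> (\<Sum>k\<in>D. norm (increment f k)) < \<epsilon>"
    by (rule absolutely_continuous_onD[OF ac \<open>0 < \<epsilon>\<close>]) (rule that)
  \<comment> \<open>The bounds give, in this order, measure at least \<open>m / 2\<close> to \<open>J\<close>, increments below \<open>\<epsilon>\<close> to the remainder, and an error of at most \<open>\<epsilon>\<close> in comparing \<open>p\<close> times the two measures.\<close>
  define \<eta> where "\<eta> = min (m / 6) (min (\<delta> / 8) (\<epsilon> / (4 * (\<bar>p\<bar> + 1))))"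
  have \<eta>: "0 < \<eta>" "\<eta> \<le> m / 6" "4 * \<eta> < \<delta>" "4 * \<eta> * \<bar>p\<bar> \<le> \<epsilon>"
  proof -
    show "0 < \<eta>" using m \<delta> \<open>0 < \<epsilon>\<close> by (simp add: \<eta>_def)
    show "\<eta> \<le> m / 6" unfolding \<eta>_def by (rule min.cobounded1)
    have "\<eta> \<le> \<delta> / 8" unfolding \<eta>_def by linarith
    then show "4 * \<eta> < \<delta>" using \<delta>(1) by linarith
    have "\<eta> \<le> \<epsilon> / (4 * (\<bar>p\<bar> + 1))" unfolding \<eta>_def by linarith
    then have "\<eta> * (4 * (\<bar>p\<bar> + 1)) \<le> \<epsilon>" by (simp add: pos_le_divide_eq)
    then show "4 * \<eta> * \<bar>p\<bar> \<le> \<epsilon>" using \<open>0 < \<eta>\<close> by (simp add: algebra_simps)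
  qed
  obtain U where U: "open U" "U \<in> lmeasurable" "?A \<subseteq> U" "measure lebesgue U < m + \<eta>"
    using m(3)[OF \<eta>(1)] by blast
  have fineI: "\<exists>u v. u < v \<and> u \<le> t \<and> t \<le> v \<and> v - u < d \<and> {u..v} \<subseteq> S \<and> f v - f u < p * (v - u)"
    if "t \<in> ?A" "0 < d" for t d
  proof -
    have "exceeds_slope (\<lambda>s. - f s) S (- p) t" using that by blast
    then obtain u v where "u < v" "u \<le> t" "t \<le> v" "v - u < d" "{u..v} \<subseteq> S"
        "(- p) * (v - u) < - f v - (- f u)"
      using \<open>0 < d\<close> unfolding exceeds_slope_def by blast
    then show ?thesis by (intro exI[of _ u] exI[of _ v]) auto
  qed
  obtain I where I: "I division_of \<Union>I" "\<Union>I \<subseteq> U" "m - \<eta> < measure lebesgue (\<Union>I)"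
      "\<And>k. k \<in> I \<Longrightarrow> \<exists>u v. u < v \<and> k = {u..v} \<and> {u..v} \<subseteq> S \<and> f v - f u < p * (v - u)"
    by (rule finite_fine_cover[OF U(1-3) m(2) fineI \<eta>(1)])
      (assumption | rule that)+
  define W where "W = interior (\<Union>I)"
  have Ilm: "\<Union>I \<in> lmeasurable" using I(1) by (rule lmeasurable_division)
  have "negligible (\<Union>I - W)"
  proof -
    have "negligible (frontier (\<Union>I))"
    proof (rule negligible_subset)
      show "negligible (\<Union>k\<in>I. frontier k)"
      proof (rule negligible_Union)
        show "finite (frontier ` I)" using I(1) by auto
        fix T assume "T \<in> frontier ` I"
        then obtain k where k: "k \<in> I" "T = frontier k" by blast
        then have "convex k" using I(4)[of k] by auto
        then show "negligible T" using k negligible_convex_frontier by blast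
      qed
      show "frontier (\<Union>I) \<subseteq> (\<Union>k\<in>I. frontier k)"
        using I(1) by (intro frontier_Union_subset) auto
    qed
    moreover have "\<Union>I - W \<subseteq> frontier (\<Union>I)"
      using closure_subset[of "\<Union>I"] by (auto simp: W_def frontier_def)
    ultimately show ?thesis by (rule negligible_subset)
  qed
  have Wopen: "open W" by (simp add: W_def)
  have Wlm: "W \<in> lmeasurable"
    using fmeasurableI2[OF Ilm, of W] interior_subset by (auto simp: W_def)
  \<comment> \<open>The part of the set outside \<open>W\<close> lies in \<open>U - \<Union>I\<close>, of measure below \<open>2 * \<eta>\<close>, and a null set.\<close>
  have low: "m - 2 * \<eta> \<le> measure lebesgue B" if B: "B \<in> lmeasurable" "?A \<inter> W \<subseteq> B" for B
  proof -
    have UI: "U - \<Union>I \<in> lmeasurable" using U Ilm by (intro fmeasurable.Diff)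
    have NI: "\<Union>I - W \<in> lmeasurable" using \<open>negligible (\<Union>I - W)\<close> by (rule negligible_imp_measurable)
    have "m \<le> measure lebesgue (B \<union> (U - \<Union>I) \<union> (\<Union>I - W))"
      using B U(3) UI NI by (intro m(2)) auto
    also have "\<dots> \<le> measure lebesgue (B \<union> (U - \<Union>I)) + measure lebesgue (\<Union>I - W)"
      using B UI NI by (intro measure_Un_le fmeasurableD) auto
    also have "measure lebesgue (\<Union>I - W) = 0"
      using \<open>negligible (\<Union>I - W)\<close> by (rule negligible_imp_measure0)
    also have "measure lebesgue (B \<union> (U - \<Union>I)) \<le> measure lebesgue B + measure lebesgue (U - \<Union>I)"
      using B UI by (intro measure_Un_le fmeasurableD)
    also have "measure lebesgue (U - \<Union>I) = measure lebesgue U - measure lebesgue (\<Union>I)"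
      using U(2) Ilm I(2) by (intro measurable_measure_Diff) (auto dest: fmeasurableD)
    finally show ?thesis using U(4) I(3) by linarith
  qed
  have fineJ: "\<exists>u v. u < v \<and> u \<le> t \<and> t \<le> v \<and> v - u < d \<and> {u..v} \<subseteq> S \<and> q * (v - u) < f v - f u"
    if "t \<in> ?A \<inter> W" "0 < d" for t d
  proof -
    have "exceeds_slope f S q t" using that by blast
    then show ?thesis using that(2) unfolding exceeds_slope_def by blast
  qed
  obtain J where J: "J division_of \<Union>J" "\<Union>J \<subseteq> W" "m - 2 * \<eta> - \<eta> < measure lebesgue (\<Union>J)"
      "\<And>k. k \<in> J \<Longrightarrow> \<exists>u v. u < v \<and> k = {u..v} \<and> {u..v} \<subseteq> S \<and> q * (v - u) < f v - f u"
    by (rule finite_fine_cover[of W "?A \<inter> W" "m - 2 * \<eta>", OF Wopen Wlm Int_lower2 low fineJ \<eta>(1)])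
      (assumption | rule that)+
  have "\<Union>J \<subseteq> \<Union>I" using J(2) interior_subset unfolding W_def by blast
  obtain R where R: "R division_of \<Union>R" "\<Union>R \<subseteq> \<Union>I"
      "\<And>g :: real \<Rightarrow> real. (\<Sum>k\<in>I. increment g k) = (\<Sum>k\<in>J. increment g k) + (\<Sum>k\<in>R. increment g k)"
    by (rule division_remainder[OF I(1) J(1) \<open>\<Union>J \<subseteq> \<Union>I\<close>]) (rule that)
  define x where "x = measure lebesgue (\<Union>I)"
  define y where "y = measure lebesgue (\<Union>J)"
  have "x \<le> measure lebesgue U"
    unfolding x_def using I(2) U(2) Ilm by (intro measure_mono_fmeasurable) auto
  then have xy: "x < m + \<eta>" "m - 3 * \<eta> < y" using U(4) J(3) by (auto simp: y_def)
  have rest: "(\<Sum>k\<in>R. increment id k) = x - y"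
    using R(3)[of id] sum_increment_id[OF I(1)] sum_increment_id[OF J(1)] by (simp add: x_def y_def)
  have "0 \<le> x - y"
    using rest sum_increment_id[OF R(1)] measure_nonneg[of lebesgue "\<Union>R"] by linarith
  have "\<Union>R \<subseteq> S" using R(2) I(4) by blast
  moreover have "(\<Sum>k\<in>R. increment id k) < \<delta>" using rest xy \<eta> by simp
  ultimately have "(\<Sum>k\<in>R. norm (increment f k)) < \<epsilon>" using \<delta>(2) R(1) by blast
  then have Rf: "- \<epsilon> < (\<Sum>k\<in>R. increment f k)"
    using norm_sum[of "increment f" R] unfolding real_norm_def by linarith
  have "(\<Sum>k\<in>I. increment f k) \<le> (\<Sum>k\<in>I. p * increment id k)"
  proof (rule sum_mono)
    fix k assume "k \<in> I"
    then show "increment f k \<le> p * increment id k" using I(4)[of k] by fastforce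
  qed
  then have If: "(\<Sum>k\<in>I. increment f k) \<le> p * x"
    using sum_increment_id[OF I(1)] sum_distrib_left[of p "increment id" I] by (simp add: x_def)
  have "(\<Sum>k\<in>J. q * increment id k) \<le> (\<Sum>k\<in>J. increment f k)"
  proof (rule sum_mono)
    fix k assume "k \<in> J"
    then show "q * increment id k \<le> increment f k" using J(4)[of k] by fastforce
  qed
  then have Jf: "q * y \<le> (\<Sum>k\<in>J. increment f k)"
    using sum_increment_id[OF J(1)] sum_distrib_left[of q "increment id" J] by (simp add: y_def)
  have "q * y - \<epsilon> < p * x" using If Jf Rf R(3)[of f] by linarith
  then have "(q - p) * y < \<epsilon> + p * (x - y)" by (simp add: algebra_simps)
  also have "p * (x - y) \<le> \<bar>p\<bar> * (x - y)" using \<open>0 \<le> x - y\<close> by (intro mult_right_mono) auto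
  also have "\<dots> \<le> \<bar>p\<bar> * (4 * \<eta>)" using xy by (intro mult_left_mono) auto
  also have "\<dots> \<le> \<epsilon>" using \<eta>(4) by (simp add: algebra_simps)
  finally have "(q - p) * y < 2 * \<epsilon>" by simp
  moreover have "(q - p) * (m / 2) \<le> (q - p) * y"
    using xy \<eta>(2) \<open>p < q\<close> by (intro mult_left_mono) auto
  moreover have "(q - p) * (m / 2) = 4 * \<epsilon>" by (simp add: \<epsilon>_def)
  ultimately show False using \<open>0 < \<epsilon>\<close> by linarith
qed

lemma not_exceeds_slope:
  "\<not> exceeds_slope f S q t \<longleftrightarrow> (\<exists>d>0. \<forall>u v. u < v \<longrightarrow> u \<le> t \<longrightarrow> t \<le> v \<longrightarrow> v - u < d \<longrightarrow>
    {u..v} \<subseteq> S \<longrightarrow> f v - f u \<le> q * (v - u))"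
  by (simp only: exceeds_slope_def not_less[symmetric]) blast

text \<open>The derivative is the infimum \<open>D\<close> of the slopes that are not exceeded near \<open>t\<close>. Every \<open>q < D\<close> is
  exceeded, so by \<open>gap\<close> every rational \<open>p < q\<close> bounds the slopes near \<open>t\<close> from below. Rational
  slopes suffice, and they make the exceptional set a countable union.\<close>

lemma has_real_derivative_of_slopes:
  fixes f :: "real \<Rightarrow> real"
  assumes t: "a < t" "t < b"
    and up: "\<exists>K. \<not> exceeds_slope f {a..b} K t"
    and down: "\<exists>K. \<not> exceeds_slope (\<lambda>s. - f s) {a..b} K t"
    and gap: "\<And>p q. p \<in> \<rat> \<Longrightarrow> q \<in> \<rat> \<Longrightarrow> p < q \<Longrightarrow>
      \<not> (exceeds_slope (\<lambda>s. - f s) {a..b} (- p) t \<and> exceeds_slope f {a..b} q t)"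
  shows "\<exists>D. (f has_real_derivative D) (at t)"
proof -
  let ?S = "{q. \<not> exceeds_slope f {a..b} q t}"
  define D where "D = Inf ?S"
  have upper: "\<exists>d>0. \<forall>u v. u < v \<and> u \<le> t \<and> t \<le> v \<and> v - u < d \<longrightarrow> f v - f u \<le> q * (v - u)"
    if q: "\<not> exceeds_slope f {a..b} q t" for q
  proof -
    obtain d where d: "0 < d" "\<forall>u v. u < v \<longrightarrow> u \<le> t \<longrightarrow> t \<le> v \<longrightarrow> v - u < d \<longrightarrow>
        {u..v} \<subseteq> {a..b} \<longrightarrow> f v - f u \<le> q * (v - u)"
      using iffD1[OF not_exceeds_slope q] by blast
    show ?thesis
    proof (intro exI[of _ "min d (min (t - a) (b - t))"] conjI allI impI; (elim conjE)?)
      show "0 < min d (min (t - a) (b - t))" using d t by simp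
      fix u v assume uv: "u < v" "u \<le> t" "t \<le> v" "v - u < min d (min (t - a) (b - t))"
      then have "{u..v} \<subseteq> {a..b}" by auto
      then show "f v - f u \<le> q * (v - u)" using d(2)[rule_format, of u v] uv by simp
    qed
  qed
  have lower: "\<exists>d>0. \<forall>u v. u < v \<and> u \<le> t \<and> t \<le> v \<and> v - u < d \<longrightarrow> p * (v - u) \<le> f v - f u"
    if p: "\<not> exceeds_slope (\<lambda>s. - f s) {a..b} (- p) t" for p
  proof -
    obtain d where d: "0 < d" "\<forall>u v. u < v \<longrightarrow> u \<le> t \<longrightarrow> t \<le> v \<longrightarrow> v - u < d \<longrightarrow>
        {u..v} \<subseteq> {a..b} \<longrightarrow> - f v - - f u \<le> - p * (v - u)"
      using iffD1[OF not_exceeds_slope p] by blast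
    show ?thesis
    proof (intro exI[of _ "min d (min (t - a) (b - t))"] conjI allI impI; (elim conjE)?)
      show "0 < min d (min (t - a) (b - t))" using d t by simp
      fix u v assume uv: "u < v" "u \<le> t" "t \<le> v" "v - u < min d (min (t - a) (b - t))"
      then have "{u..v} \<subseteq> {a..b}" by auto
      then show "p * (v - u) \<le> f v - f u" using d(2)[rule_format, of u v] uv by simp
    qed
  qed
  have order: "p \<le> q"
    if p: "\<not> exceeds_slope (\<lambda>s. - f s) {a..b} (- p) t" and q: "\<not> exceeds_slope f {a..b} q t" for p q
  proof -
    obtain d where d: "0 < d" "\<forall>u v. u < v \<and> u \<le> t \<and> t \<le> v \<and> v - u < d \<longrightarrow> f v - f u \<le> q * (v - u)"
      using upper[OF q] by blast
    obtain e where e: "0 < e" "\<forall>u v. u < v \<and> u \<le> t \<and> t \<le> v \<and> v - u < e \<longrightarrow> p * (v - u) \<le> f v - f u"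
      using lower[OF p] by blast
    define h where "h = min d e / 2"
    have h: "0 < h" "h < d" "h < e" using d(1) e(1) by (auto simp: h_def)
    have "f (t + h) - f t \<le> q * h" using d(2)[rule_format, of t "t + h"] h by simp
    moreover have "p * h \<le> f (t + h) - f t" using e(2)[rule_format, of t "t + h"] h by simp
    ultimately have "p * h \<le> q * h" by linarith
    then show ?thesis using h(1) by simp
  qed
  obtain K where K: "\<not> exceeds_slope (\<lambda>s. - f s) {a..b} K t" using down by blast
  have ne: "?S \<noteq> {}" using up by blast
  have bdd: "bdd_below ?S" using order[of "- K"] K by (intro bdd_belowI[of _ "- K"]) auto
  have slopes: "\<exists>d>0. \<forall>u v. u < v \<and> u \<le> t \<and> t \<le> v \<and> v - u < d \<longrightarrow>
      \<bar>f v - f u - D * (v - u)\<bar> \<le> \<epsilon> * (v - u)" if "0 < \<epsilon>" for \<epsilon>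
  proof -
    obtain q where q: "\<not> exceeds_slope f {a..b} q t" "q < D + \<epsilon>"
      using cInf_lessD[OF ne, of "D + \<epsilon>"] \<open>0 < \<epsilon>\<close> by (auto simp: D_def)
    obtain p' where p': "p' \<in> \<rat>" "D - \<epsilon> < p'" "p' < D"
      using Rats_dense_in_real[of "D - \<epsilon>" D] \<open>0 < \<epsilon>\<close> by auto
    obtain q' where q': "q' \<in> \<rat>" "p' < q'" "q' < D"
      using Rats_dense_in_real[OF p'(3)] by auto
    have "exceeds_slope f {a..b} q' t"
      using q'(3) cInf_lower[OF _ bdd, of q'] by (force simp: D_def)
    then have p: "\<not> exceeds_slope (\<lambda>s. - f s) {a..b} (- p') t" using gap p' q' by blast
    obtain d where d: "0 < d" "\<forall>u v. u < v \<and> u \<le> t \<and> t \<le> v \<and> v - u < d \<longrightarrow> f v - f u \<le> q * (v - u)"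
      using upper[OF q(1)] by blast
    obtain e where e: "0 < e" "\<forall>u v. u < v \<and> u \<le> t \<and> t \<le> v \<and> v - u < e \<longrightarrow> p' * (v - u) \<le> f v - f u"
      using lower[OF p] by blast
    show ?thesis
    proof (intro exI[of _ "min d e"] conjI allI impI; (elim conjE)?)
      show "0 < min d e" using d e by simp
      fix u v assume uv: "u < v" "u \<le> t" "t \<le> v" "v - u < min d e"
      have "f v - f u \<le> q * (v - u)" "p' * (v - u) \<le> f v - f u" using d e uv by auto
      moreover have "q * (v - u) \<le> (D + \<epsilon>) * (v - u)" "(D - \<epsilon>) * (v - u) \<le> p' * (v - u)"
        using q p' uv by (auto intro!: mult_right_mono)
      ultimately show "\<bar>f v - f u - D * (v - u)\<bar> \<le> \<epsilon> * (v - u)"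
        by (simp add: abs_le_iff algebra_simps)
    qed
  qed
  have "(f has_derivative (\<lambda>h. D * h)) (at t)"
    unfolding has_derivative_within_alt
  proof (intro conjI allI impI)
    show "bounded_linear (\<lambda>h. D * h)" by (rule bounded_linear_mult_right)
    fix \<epsilon> :: real assume "0 < \<epsilon>"
    then obtain d where d: "0 < d" "\<forall>u v. u < v \<and> u \<le> t \<and> t \<le> v \<and> v - u < d \<longrightarrow>
        \<bar>f v - f u - D * (v - u)\<bar> \<le> \<epsilon> * (v - u)" using slopes by blast
    have "norm (f y - f t - D * (y - t)) \<le> \<epsilon> * norm (y - t)" if y: "norm (y - t) < d" for y
    proof (cases y t rule: linorder_cases)
      case less
      then have "\<bar>f t - f y - D * (t - y)\<bar> \<le> \<epsilon> * (t - y)" using d(2) y by auto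
      moreover have "f y - f t - D * (y - t) = - (f t - f y - D * (t - y))" by (simp add: algebra_simps)
      ultimately show ?thesis using less by (simp only: real_norm_def abs_minus_cancel) simp
    next
      case equal
      then show ?thesis by simp
    next
      case greater
      then show ?thesis using d(2) y by auto
    qed
    then show "\<exists>d>0. \<forall>y\<in>UNIV. norm (y - t) < d \<longrightarrow> norm (f y - f t - D * (y - t)) \<le> \<epsilon> * norm (y - t)"
      using d(1) by blast
  qed
  then show ?thesis by (auto simp: has_field_derivative_def)
qed

lemma absolutely_continuous_on_differentiable_ae:
  fixes f :: "real \<Rightarrow> real"
  assumes ac: "absolutely_continuous_on {a..b} f"
  obtains N where "negligible N" "\<And>t. t \<in> {a..b} - N \<Longrightarrow> \<exists>D. (f has_real_derivative D) (at t)"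
proof -
  let ?g = "\<lambda>s. - f s"
  have ac': "absolutely_continuous_on {a..b} ?g"
    by (rule absolutely_continuous_on_lipschitz_comp[OF ac, of _ 1]) (simp add: norm_minus_commute)
  define G where "G = (\<Union>(p, q) \<in> {(p, q). p \<in> \<rat> \<and> q \<in> \<rat> \<and> p < q}.
    {t. exceeds_slope ?g {a..b} (- p) t \<and> exceeds_slope f {a..b} q t})"
  have cnt: "countable {(p, q). p \<in> \<rat> \<and> q \<in> \<rat> \<and> p < (q :: real)}"
    by (rule countable_subset[of _ "\<rat> \<times> \<rat>"]) (auto intro: countable_rat)
  have "negligible G"
    unfolding G_def
  proof (rule negligible_countable_Union)
    show "countable ((\<lambda>(p, q). {t. exceeds_slope ?g {a..b} (- p) t \<and> exceeds_slope f {a..b} q t}) `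
        {(p, q). p \<in> \<rat> \<and> q \<in> \<rat> \<and> p < q})" using cnt by (rule countable_image)
  qed (use slope_gap_negligible[OF ac bounded_closed_interval] in auto)
  define N where "N = {a, b} \<union> G \<union> {t. \<forall>K. exceeds_slope f {a..b} K t} \<union>
      {t. \<forall>K. exceeds_slope ?g {a..b} K t}"
  have "negligible N"
    unfolding N_def using \<open>negligible G\<close> infinite_slope_negligible[OF ac]
      infinite_slope_negligible[OF ac'] by (intro negligible_Un) auto
  moreover have "\<exists>D. (f has_real_derivative D) (at t)" if t: "t \<in> {a..b} - N" for t
    by (rule has_real_derivative_of_slopes[of a t b]) (use t in \<open>auto simp: N_def G_def\<close>)
  ultimately show thesis by (rule that)
qed

lemma absolutely_continuous_on_vector_differentiable_ae:
  fixes f :: "real \<Rightarrow> 'a::euclidean_space"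
  assumes ac: "absolutely_continuous_on {a..b} f"
  obtains N where "negligible N"
    "\<And>t. t \<in> {a..b} - N \<Longrightarrow> (f has_vector_derivative vector_derivative f (at t)) (at t)"
proof -
  have "\<exists>N. negligible N \<and>
      (\<forall>t \<in> {a..b} - N. \<exists>D. ((\<lambda>s. f s \<bullet> i) has_real_derivative D) (at t))"
    if "i \<in> Basis" for i
  proof -
    have "absolutely_continuous_on {a..b} (\<lambda>s. f s \<bullet> i)"
    proof (rule absolutely_continuous_on_lipschitz_comp[OF ac])
      fix s t
      show "norm (f s \<bullet> i - f t \<bullet> i) \<le> 1 * norm (f s - f t)"
        using Basis_le_norm[OF that, of "f s - f t"] by (simp add: inner_diff_left)
    qed
    then show ?thesis using absolutely_continuous_on_differentiable_ae by metis
  qed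
  then obtain N where N: "\<And>i. i \<in> Basis \<Longrightarrow> negligible (N i)"
      "\<And>i. i \<in> Basis \<Longrightarrow> \<forall>t \<in> {a..b} - N i. \<exists>D. ((\<lambda>s. f s \<bullet> i) has_real_derivative D) (at t)"
    by metis
  show thesis
  proof (rule that[of "\<Union>i\<in>Basis. N i"])
    show "negligible (\<Union>i\<in>Basis. N i)" using N(1) by (intro negligible_Union) auto
    fix t assume "t \<in> {a..b} - (\<Union>i\<in>Basis. N i)"
    then have "\<forall>i\<in>Basis. \<exists>D. ((\<lambda>s. f s \<bullet> i) has_real_derivative D) (at t)" using N(2) by blast
    then obtain D where D: "\<And>i. i \<in> Basis \<Longrightarrow> ((\<lambda>s. f s \<bullet> i) has_real_derivative D i) (at t)"
      by metis
    have "(f has_derivative (\<lambda>h. h *\<^sub>R (\<Sum>i\<in>Basis. D i *\<^sub>R i))) (at t)"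
      unfolding has_derivative_componentwise_within[of f]
      using D by (auto simp: has_field_derivative_def mult_commute_abs)
    then have "f differentiable at t" by (auto simp: differentiable_def)
    then show "(f has_vector_derivative vector_derivative f (at t)) (at t)"
      by (rule vector_derivative_works[THEN iffD1])
  qed
qed

section \<open>The fundamental theorem of calculus\<close>

lemma sum_tagged_increment_small:
  fixes f :: "real \<Rightarrow> 'a::real_normed_vector"
  assumes p: "p tagged_division_of {a..b}" and q: "q \<subseteq> p"
    and U: "U \<in> lmeasurable" "\<And>x k. (x, k) \<in> q \<Longrightarrow> k \<subseteq> U" "measure lebesgue U < \<delta>"
    and \<delta>: "\<And>D T. \<lbrakk>D division_of T; T \<subseteq> {a..b}; (\<Sum>k\<in>D. increment id k) < \<delta>\<rbrakk>
       \<Longrightarrow> (\<Sum>k\<in>D. norm (increment f k)) < \<epsilon>"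
  shows "(\<Sum>(x, k)\<in>q. norm (increment f k)) < \<epsilon>"
proof -
  let ?T = "\<Union>(snd ` q)"
  have "q tagged_partial_division_of {a..b}"
    using tagged_partial_division_subset[OF _ q] p by (auto simp: tagged_division_of_def)
  then have tq: "q tagged_division_of ?T" by (rule tagged_partial_division_of_Union_self)
  then have D: "(snd ` q) division_of ?T" by (rule division_of_tagged_division)
  define d where "d = (\<lambda>k. if k = {} then 0 else norm (increment f k))"
  have "(\<Sum>(x, k)\<in>q. d k) = (\<Sum>k\<in>snd ` q. d k)"
  proof (rule sum.over_tagged_division_lemma[OF tq])
    fix u v :: real assume "box u v = {}"
    then show "d (cbox u v) = 0" by (auto simp: d_def increment_def)
  qed
  moreover have "d k = norm (increment f k)" if "k \<in> snd ` q" for k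
    using division_ofD(3)[OF D that] by (simp add: d_def)
  then have "(\<Sum>(x, k)\<in>q. d k) = (\<Sum>(x, k)\<in>q. norm (increment f k))"
    "(\<Sum>k\<in>snd ` q. d k) = (\<Sum>k\<in>snd ` q. norm (increment f k))"
    by (force intro!: sum.cong)+
  moreover have "(\<Sum>k\<in>snd ` q. norm (increment f k)) < \<epsilon>"
  proof (rule \<delta>[OF D])
    show "?T \<subseteq> {a..b}" using p q by force
    have "measure lebesgue ?T \<le> measure lebesgue U"
    proof (rule measure_mono_fmeasurable)
      show "?T \<subseteq> U" using U(2) by fastforce
    qed (use U(1) fmeasurableD[OF lmeasurable_division[OF D]] in auto)
    then show "(\<Sum>k\<in>snd ` q. increment id k) < \<delta>"
      using sum_increment_id[OF D] U(3) by simp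
  qed
  ultimately show ?thesis by simp
qed

text \<open>The fundamental theorem of calculus for the Henstock-Kurzweil integral. At points outside \<open>N\<close> the
  derivative provides the gauge. At points of \<open>N\<close> the gauge keeps all intervals inside an open set of
  measure below \<open>\<delta>\<close>, so that their increments are small by absolute continuity; setting the integrand to
  0 on \<open>N\<close> removes their other contribution.\<close>

theorem absolutely_continuous_has_integral:
  fixes f :: "real \<Rightarrow> real"
  assumes ac: "absolutely_continuous_on {a..b} f" and ab: "a \<le> b" and N: "negligible N"
    and deriv: "\<And>t. t \<in> {a..b} - N \<Longrightarrow> (f has_real_derivative f' t) (at t)"
  shows "(f' has_integral (f b - f a)) {a..b}"
proof -
  define g where "g t = (if t \<in> N then 0 else f' t)" for t
  have "(g has_integral (f b - f a)) {a..b}"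
    unfolding has_integral_real
  proof (intro allI impI)
    fix e :: real assume "0 < e"
    define l where "l = b - a + 1"
    define \<epsilon> where "\<epsilon> = e / (2 * l)"
    have "0 < l" using ab by (simp add: l_def)
    have \<epsilon>: "0 < \<epsilon>" "\<epsilon> * (b - a) \<le> e / 2"
    proof -
      show "0 < \<epsilon>" using \<open>0 < e\<close> \<open>0 < l\<close> by (simp add: \<epsilon>_def)
      then have "\<epsilon> * (b - a) \<le> \<epsilon> * l" by (intro mult_left_mono) (auto simp: l_def)
      also have "\<dots> = e / 2" using \<open>0 < l\<close> by (simp add: \<epsilon>_def)
      finally show "\<epsilon> * (b - a) \<le> e / 2" .
    qed
    obtain \<delta> where \<delta>: "0 < \<delta>" "\<And>D T. \<lbrakk>D division_of T; T \<subseteq> {a..b}; (\<Sum>k\<in>D. increment id k) < \<delta>\<rbrakk>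
       \<Longrightarrow> (\<Sum>k\<in>D. norm (increment f k)) < e / 2"
      by (rule absolutely_continuous_onD[OF ac half_gt_zero[OF \<open>0 < e\<close>]]) (rule that)
    obtain U where U: "open U" "U \<in> lmeasurable" "N \<subseteq> U" "measure lebesgue U < \<delta>"
    proof (rule lmeasurable_open_superset[OF negligible_imp_measurable[OF N] \<delta>(1)])
      fix U assume "open U" "U \<in> lmeasurable" "N \<subseteq> U" "measure lebesgue U < measure lebesgue N + \<delta>"
      then show thesis using negligible_imp_measure0[OF N] by (intro that) auto
    qed
    have "\<exists>d>0. \<forall>y. \<bar>y - t\<bar> < d \<longrightarrow> \<bar>f y - f t - f' t * (y - t)\<bar> \<le> \<epsilon> * \<bar>y - t\<bar>"
      if t: "t \<in> {a..b} - N" for t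
      using deriv[OF t] \<epsilon>(1) unfolding has_field_derivative_def has_derivative_within_alt by simp
    then obtain d where d: "\<And>t. t \<in> {a..b} - N \<Longrightarrow> 0 < d t"
        "\<And>t y. t \<in> {a..b} - N \<Longrightarrow> \<bar>y - t\<bar> < d t \<Longrightarrow> \<bar>f y - f t - f' t * (y - t)\<bar> \<le> \<epsilon> * \<bar>y - t\<bar>"
      by metis
    define \<gamma> where "\<gamma> t = (if t \<in> N then U else if t \<in> {a..b} then ball t (d t) else UNIV)" for t
    have "gauge \<gamma>" using U d(1) by (auto simp: gauge_def \<gamma>_def)
    moreover have "norm ((\<Sum>(x, k)\<in>p. measure lborel k *\<^sub>R g x) - (f b - f a)) < e"
      if p: "p tagged_division_of {a..b}" "\<gamma> fine p" for p
    proof -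
      note pD = tagged_division_ofD[OF p(1)]
      let ?r = "\<lambda>x k. measure lborel k *\<^sub>R g x - increment f k"
      define q where "q = {(x, k) \<in> p. x \<in> N}"
      have fin: "finite p" using pD(1) .
      have "(\<Sum>(x, k)\<in>q. norm (increment f k)) < e / 2"
      proof (rule sum_tagged_increment_small[OF p(1) _ U(2) _ U(4)])
        show "q \<subseteq> p" by (auto simp: q_def)
        show "k \<subseteq> U" if "(x, k) \<in> q" for x k
          using that fineD[OF p(2), of x k] by (auto simp: q_def \<gamma>_def)
      qed (use \<delta>(2) in auto)
      moreover have "(\<Sum>(x, k)\<in>q. \<bar>?r x k\<bar>) = (\<Sum>(x, k)\<in>q. norm (increment f k))"
        by (rule sum.cong) (auto simp: q_def g_def)
      ultimately have sq: "(\<Sum>(x, k)\<in>q. \<bar>?r x k\<bar>) < e / 2" by simp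
      have "\<bar>?r x k\<bar> \<le> \<epsilon> * measure lborel k" if xk: "(x, k) \<in> p - q" for x k
      proof -
        have xp: "(x, k) \<in> p" and xN: "x \<notin> N" using xk by (auto simp: q_def)
        obtain u v where k: "k = {u..v}" using pD(4)[OF xp] by auto
        have "x \<in> k" "k \<subseteq> {a..b}" using pD(2,3)[OF xp] by auto
        then have x: "x \<in> {a..b} - N" "u \<le> x" "x \<le> v" using xN k by auto
        have "k \<subseteq> ball x (d x)" using fineD[OF p(2) xp] x by (simp add: \<gamma>_def)
        moreover have "u \<in> k" "v \<in> k" using k x by auto
        ultimately have "\<bar>u - x\<bar> < d x" "\<bar>v - x\<bar> < d x"
          by (auto simp: dist_real_def abs_minus_commute)
        then have "\<bar>f u - f x - f' x * (u - x)\<bar> \<le> \<epsilon> * (x - u)"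
          "\<bar>f v - f x - f' x * (v - x)\<bar> \<le> \<epsilon> * (v - x)"
          using d(2)[OF x(1), of u] d(2)[OF x(1), of v] x by auto
        moreover have "?r x k = (f u - f x - f' x * (u - x)) - (f v - f x - f' x * (v - x))"
          using k x xN by (simp add: g_def algebra_simps)
        moreover have "\<epsilon> * measure lborel k = \<epsilon> * (x - u) + \<epsilon> * (v - x)"
          using k x by (simp add: algebra_simps)
        ultimately show ?thesis by linarith
      qed
      then have "(\<Sum>(x, k)\<in>p - q. \<bar>?r x k\<bar>) \<le> (\<Sum>(x, k)\<in>p - q. \<epsilon> * measure lborel k)"
        by (intro sum_mono) auto
      also have "\<dots> \<le> (\<Sum>(x, k)\<in>p. \<epsilon> * measure lborel k)"
        using fin \<epsilon>(1) by (intro sum_mono2) (auto intro!: mult_nonneg_nonneg)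
      also have "\<dots> = \<epsilon> * (\<Sum>(x, k)\<in>p. measure lborel k)" by (simp add: sum_distrib_left split_def)
      also have "\<dots> = \<epsilon> * (b - a)" using additive_content_tagged_division[of p a b] p(1) ab by simp
      finally have spq: "(\<Sum>(x, k)\<in>p - q. \<bar>?r x k\<bar>) \<le> e / 2" using \<epsilon>(2) by simp
      have "(\<Sum>(x, k)\<in>p. increment f k) = f b - f a"
        using additive_tagged_division_1[OF ab p(1), of f] by (simp add: increment_def)
      then have "(\<Sum>(x, k)\<in>p. measure lborel k *\<^sub>R g x) - (f b - f a) = (\<Sum>(x, k)\<in>p. ?r x k)"
        by (simp add: split_def sum_subtractf)
      also have "norm \<dots> \<le> (\<Sum>(x, k)\<in>p. \<bar>?r x k\<bar>)"
        using norm_sum[of "\<lambda>(x, k). ?r x k" p] by (simp add: split_def)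
      also have "\<dots> = (\<Sum>(x, k)\<in>p - q. \<bar>?r x k\<bar>) + (\<Sum>(x, k)\<in>q. \<bar>?r x k\<bar>)"
        using fin by (intro sum.subset_diff) (auto simp: q_def)
      also have "\<dots> < e" using sq spq by simp
      finally show ?thesis .
    qed
    ultimately show "\<exists>\<gamma>. gauge \<gamma> \<and> (\<forall>p. p tagged_division_of {a..b} \<and> \<gamma> fine p \<longrightarrow>
        norm ((\<Sum>(x, k)\<in>p. measure lborel k *\<^sub>R g x) - (f b - f a)) < e)"
      by (intro exI[of _ \<gamma>] conjI allI impI; (elim conjE)?)
  qed
  then show ?thesis by (rule has_integral_spike[OF N, rotated]) (simp add: g_def)
qed

text \<open>If \<open>F\<close> dominates the differential of \<open>h\<close>, the action of a path is at least the gain of \<open>h\<close> along it. The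
  constant \<open>c\<close> is a multiplier for the duration, which is prescribed for Euler-Lagrange minimizers.\<close>

lemma calibration:
  fixes \<beta> :: "real \<Rightarrow> 'a::euclidean_space"
  assumes ac: "absolutely_continuous_on {a..b} \<beta>" and ab: "a \<le> b"
    and lip: "\<And>x y. \<bar>h x - h y\<bar> \<le> C * norm (x - y)"
    and H: "\<And>x. (h has_derivative H x) (at x)"
    and int: "(\<lambda>t. F (\<beta> t) (vector_derivative \<beta> (at t))) integrable_on {a..b}"
    and le: "\<And>t v. t \<in> {a..b} \<Longrightarrow> H (\<beta> t) v + c \<le> F (\<beta> t) v"
  shows "h (\<beta> b) - h (\<beta> a) + c * (b - a) \<le> integral {a..b} (\<lambda>t. F (\<beta> t) (vector_derivative \<beta> (at t)))"
proof -
  let ?v = "\<lambda>t. vector_derivative \<beta> (at t)"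
  obtain N where N: "negligible N"
      "\<And>t. t \<in> {a..b} - N \<Longrightarrow> (\<beta> has_vector_derivative ?v t) (at t)"
    by (rule absolutely_continuous_on_vector_differentiable_ae[OF ac]) (rule that)
  have "absolutely_continuous_on {a..b} (\<lambda>t. h (\<beta> t))"
    by (rule absolutely_continuous_on_lipschitz_comp[OF ac]) (use lip in auto)
  then have "((\<lambda>t. H (\<beta> t) (?v t)) has_integral (h (\<beta> b) - h (\<beta> a))) {a..b}"
  proof (rule absolutely_continuous_has_integral[OF _ ab N(1)])
    fix t assume "t \<in> {a..b} - N"
    then have "(\<beta> has_derivative (\<lambda>s. s *\<^sub>R ?v t)) (at t)"
      using N(2) by (simp add: has_vector_derivative_def)
    then have "((\<lambda>s. h (\<beta> s)) has_derivative (\<lambda>s. H (\<beta> t) (s *\<^sub>R ?v t))) (at t)"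
      using H by (rule has_derivative_compose)
    moreover have "H (\<beta> t) (s *\<^sub>R ?v t) = H (\<beta> t) (?v t) * s" for s
      using linear_cmul[OF has_derivative_linear[OF H]] by (simp add: mult.commute)
    ultimately show "((\<lambda>s. h (\<beta> s)) has_real_derivative H (\<beta> t) (?v t)) (at t)"
      by (simp add: has_field_derivative_def)
  qed
  moreover have "((\<lambda>t. c) has_integral (c * (b - a))) {a..b}"
    using has_integral_const_real[of c a b] ab by (simp add: mult.commute)
  ultimately have "((\<lambda>t. H (\<beta> t) (?v t) + c) has_integral (h (\<beta> b) - h (\<beta> a) + c * (b - a))) {a..b}"
    by (rule has_integral_add)
  then show ?thesis
    using integrable_integral[OF int] by (rule has_integral_le) (use le in auto)
qed

section \<open>The Euler-Lagrange minimizer\<close>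

text \<open>The motion with speed \<open>6 / 5\<close> along the line where the sine is -1; its energy is \<open>- 7 / 25\<close>. The duration
  50 is chosen between two bounds. It is long enough for a path in the Jacobi metric to gain by going over
  to the line where the sine is 1, and short enough for such a transition not to pay off at fixed time.\<close>

definition uniform_path :: "real \<Rightarrow> real^2" where
  "uniform_path t = vector [- (pi / 2), 0] + t *\<^sub>R vector [0, 6 / 5]"

lemma uniform_path_nth [simp]: "uniform_path t $ 1 = - (pi / 2)" "uniform_path t $ 2 = 6 / 5 * t"
  by (simp_all add: uniform_path_def)

lemma uniform_path_has_vector_derivative:
  "(uniform_path has_vector_derivative vector [0, 6 / 5]) (at t within S)"
  unfolding uniform_path_def[abs_def]
  by (auto intro!: derivative_eq_intros)

lemma norm_real_2: "(norm (v :: real^2))\<^sup>2 = (v $ 1)\<^sup>2 + (v $ 2)\<^sup>2"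
  by (simp add: norm_vec_def L2_set_def sum_2)

lemma alpha_pos: "0 < alpha s"
  using sin_ge_minus_one[of s] unfolding alpha_def by linarith

lemma potential_eq: "potential s = - ((3 - 2 * (sin s)\<^sup>2) / alpha s)"
  by (simp add: potential_def alpha_def cos_double_sin)

lemma alpha_times_lagrangian:
  "alpha (x $ 1) * lagrangian x v =
    ((alpha (x $ 1))\<^sup>2 * ((v $ 1)\<^sup>2 + (v $ 2)\<^sup>2)) / 2 + 3 - 2 * (sin (x $ 1))\<^sup>2"
proof -
  define a n where "a = alpha (x $ 1)" and "n = 3 - 2 * (sin (x $ 1))\<^sup>2"
  have "a * lagrangian x v = a * (a / 2 * (norm v)\<^sup>2) + a * (n / a)"
    by (simp add: lagrangian_def potential_eq distrib_left a_def n_def)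
  also have "a * (n / a) = n" using alpha_pos[of "x $ 1"] by (simp add: a_def)
  finally show ?thesis by (simp add: norm_real_2 a_def n_def power2_eq_square[of "alpha _"])
qed

text \<open>Completing the square in \<open>v $ 2\<close> leaves \<open>(1 + s) * (43 / 25 - 2 * s)\<close> with \<open>s = sin (x $ 1)\<close>, which is
  nonnegative as long as \<open>s\<close> stays away from 1. Equality holds along the uniform path.\<close>

lemma lagrangian_ge_slow:
  assumes "sin (x $ 1) \<le> 1 / 2"
  shows "6 / 5 * v $ 2 + 7 / 25 \<le> lagrangian x v"
proof -
  define s a where "s = sin (x $ 1)" and "a = alpha (x $ 1)"
  have a: "0 < a" "a = 2 + s" using alpha_pos by (auto simp: a_def s_def alpha_def)
  have "0 \<le> 1 + s" using sin_ge_minus_one[of "x $ 1"] unfolding s_def by linarith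
  moreover have "0 \<le> 43 / 25 - 2 * s" using assms by (simp add: s_def)
  ultimately have "0 \<le> (1 + s) * (43 / 25 - 2 * s)" by (rule mult_nonneg_nonneg)
  moreover have "a * (lagrangian x v - (6 / 5 * v $ 2 + 7 / 25)) =
      ((a * v $ 1)\<^sup>2 + (a * v $ 2 - 6 / 5)\<^sup>2) / 2 + (1 + s) * (43 / 25 - 2 * s)"
  proof -
    have "a * (lagrangian x v - (6 / 5 * v $ 2 + 7 / 25)) =
        a * lagrangian x v - a * (6 / 5 * v $ 2 + 7 / 25)" by (rule right_diff_distrib)
    also have "a * lagrangian x v = (a\<^sup>2 * ((v $ 1)\<^sup>2 + (v $ 2)\<^sup>2)) / 2 + 3 - 2 * s\<^sup>2"
      unfolding a_def s_def by (rule alpha_times_lagrangian)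
    finally show ?thesis unfolding a(2) by (simp add: field_simps power2_eq_square)
  qed
  ultimately have "0 \<le> a * (lagrangian x v - (6 / 5 * v $ 2 + 7 / 25))" by simp
  then show ?thesis using a(1) by (simp add: zero_le_mult_iff)
qed

text \<open>The same at energy 0, where both lines are calibrated: the remaining potential is a multiple of
  \<open>(cos (x $ 1))\<^sup>2\<close>, and the square in \<open>v $ 1\<close> is completed with \<open>2 * \<sigma> * cos (x $ 1)\<close>, the derivative of
  \<open>2 * \<sigma> * sin (x $ 1)\<close>. So moving between the lines costs twice the change of the sine.\<close>

lemma lagrangian_ge_transition:
  assumes "\<sigma>\<^sup>2 \<le> 1"
  shows "sqrt 2 * v $ 2 + 2 * \<sigma> * cos (x $ 1) * v $ 1 \<le> lagrangian x v"
proof -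
  define s c a where "s = sin (x $ 1)" and "c = cos (x $ 1)" and "a = alpha (x $ 1)"
  have a: "0 < a" using alpha_pos by (auto simp: a_def)
  have c: "c\<^sup>2 = 1 - s\<^sup>2" by (simp add: c_def s_def cos_squared_eq)
  have "0 \<le> 2 * (1 - \<sigma>\<^sup>2) * c\<^sup>2" using assms by simp
  moreover have "a * (lagrangian x v - (sqrt 2 * v $ 2 + 2 * \<sigma> * c * v $ 1)) =
      ((a * v $ 1 - 2 * \<sigma> * c)\<^sup>2 + (a * v $ 2 - sqrt 2)\<^sup>2) / 2 + 2 * (1 - \<sigma>\<^sup>2) * c\<^sup>2"
  proof -
    have "a * (lagrangian x v - (sqrt 2 * v $ 2 + 2 * \<sigma> * c * v $ 1)) =
        a * lagrangian x v - a * (sqrt 2 * v $ 2 + 2 * \<sigma> * c * v $ 1)" by (rule right_diff_distrib)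
    also have "a * lagrangian x v = (a\<^sup>2 * ((v $ 1)\<^sup>2 + (v $ 2)\<^sup>2)) / 2 + 3 - 2 * s\<^sup>2"
      unfolding a_def s_def by (rule alpha_times_lagrangian)
    also have "\<dots> = (a\<^sup>2 * ((v $ 1)\<^sup>2 + (v $ 2)\<^sup>2)) / 2 + 1 + 2 * c\<^sup>2" using c by simp
    finally show ?thesis by (simp add: power2_diff power_mult_distrib field_simps)
  qed
  ultimately have "0 \<le> a * (lagrangian x v - (sqrt 2 * v $ 2 + 2 * \<sigma> * c * v $ 1))" by simp
  then show ?thesis using a by (simp add: zero_le_mult_iff c_def)
qed

lemma vec_nth_has_derivative: "((\<lambda>x. x $ i) has_derivative (\<lambda>v. v $ i)) F"
  by (rule bounded_linear_imp_has_derivative[OF bounded_linear_vec_nth])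

lemma abs_sin_diff_le: "\<bar>sin x - sin y\<bar> \<le> \<bar>x - y :: real\<bar>"
proof -
  have "norm (sin x - sin y) \<le> 1 * norm (x - y)"
    by (rule field_differentiable_bound[of UNIV sin cos 1])
      (auto intro: DERIV_sin)
  then show ?thesis by simp
qed

lemma calibration_slow:
  fixes \<beta> :: "real \<Rightarrow> real^2"
  assumes "absolutely_continuous_on {a..b} \<beta>" "a \<le> b"
    and "(\<lambda>t. lagrangian (\<beta> t) (vector_derivative \<beta> (at t))) integrable_on {a..b}"
    and "\<And>t. t \<in> {a..b} \<Longrightarrow> sin (\<beta> t $ 1) \<le> 1 / 2"
  shows "6 / 5 * (\<beta> b $ 2 - \<beta> a $ 2) + 7 / 25 * (b - a) \<le>
    integral {a..b} (\<lambda>t. lagrangian (\<beta> t) (vector_derivative \<beta> (at t)))"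
proof -
  have "6 / 5 * \<beta> b $ 2 - 6 / 5 * \<beta> a $ 2 + 7 / 25 * (b - a) \<le>
    integral {a..b} (\<lambda>t. lagrangian (\<beta> t) (vector_derivative \<beta> (at t)))"
  proof (rule calibration[where H = "\<lambda>x v. 6 / 5 * v $ 2" and C = "6 / 5"])
    show "\<bar>6 / 5 * x $ 2 - 6 / 5 * y $ 2\<bar> \<le> 6 / 5 * norm (x - y)" for x y :: "real^2"
      using component_le_norm_cart[of "x - y" 2] unfolding vector_minus_component by linarith
    show "((\<lambda>x. 6 / 5 * x $ 2) has_derivative (\<lambda>v. 6 / 5 * v $ 2)) (at x)" for x :: "real^2"
      by (auto intro!: derivative_eq_intros vec_nth_has_derivative)
  qed (use assms lagrangian_ge_slow in auto)
  then show ?thesis by (simp add: algebra_simps)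
qed

lemma calibration_transition:
  fixes \<beta> :: "real \<Rightarrow> real^2"
  assumes "absolutely_continuous_on {a..b} \<beta>" "a \<le> b"
    and "(\<lambda>t. lagrangian (\<beta> t) (vector_derivative \<beta> (at t))) integrable_on {a..b}"
    and \<sigma>: "\<sigma>\<^sup>2 \<le> 1"
  shows "sqrt 2 * (\<beta> b $ 2 - \<beta> a $ 2) + 2 * \<sigma> * (sin (\<beta> b $ 1) - sin (\<beta> a $ 1)) \<le>
    integral {a..b} (\<lambda>t. lagrangian (\<beta> t) (vector_derivative \<beta> (at t)))"
proof -
  let ?h = "\<lambda>x :: real^2. sqrt 2 * x $ 2 + 2 * \<sigma> * sin (x $ 1)"
  have "?h (\<beta> b) - ?h (\<beta> a) + 0 * (b - a) \<le>
    integral {a..b} (\<lambda>t. lagrangian (\<beta> t) (vector_derivative \<beta> (at t)))"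
  proof (rule calibration[where H = "\<lambda>x v. sqrt 2 * v $ 2 + 2 * \<sigma> * cos (x $ 1) * v $ 1"
        and C = "sqrt 2 + 2 * \<bar>\<sigma>\<bar>"])
    show "\<bar>?h x - ?h y\<bar> \<le> (sqrt 2 + 2 * \<bar>\<sigma>\<bar>) * norm (x - y)" for x y :: "real^2"
    proof -
      have 1: "\<bar>sqrt 2 * (x $ 2 - y $ 2)\<bar> \<le> sqrt 2 * norm (x - y)"
        using component_le_norm_cart[of "x - y" 2] by (simp add: abs_mult)
      have "\<bar>sin (x $ 1) - sin (y $ 1)\<bar> \<le> norm (x - y)"
        using abs_sin_diff_le[of "x $ 1" "y $ 1"] component_le_norm_cart[of "x - y" 1] by simp
      then have 2: "\<bar>2 * \<sigma> * (sin (x $ 1) - sin (y $ 1))\<bar> \<le> 2 * \<bar>\<sigma>\<bar> * norm (x - y)"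
        by (simp add: abs_mult mult_left_mono)
      have "?h x - ?h y = sqrt 2 * (x $ 2 - y $ 2) + 2 * \<sigma> * (sin (x $ 1) - sin (y $ 1))"
        by (simp add: algebra_simps)
      then show ?thesis using 1 2 unfolding distrib_right by linarith
    qed
    show "(?h has_derivative (\<lambda>v. sqrt 2 * v $ 2 + 2 * \<sigma> * cos (x $ 1) * v $ 1)) (at x)" for x
      by (auto intro!: derivative_eq_intros vec_nth_has_derivative)
  qed (use assms lagrangian_ge_transition[OF \<sigma>] in auto)
  then show ?thesis by (simp add: algebra_simps)
qed

lemma path_functional_geI:
  assumes "(\<lambda>t. F (c t) (vector_derivative c (at t))) integrable_on {a..b} \<Longrightarrow>
    K \<le> integral {a..b} (\<lambda>t. F (c t) (vector_derivative c (at t)))"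
  shows "ereal K \<le> path_functional F a b c"
  using assms unfolding path_functional_def by (simp add: set_lebesgue_integral_eq_integral)

lemma path_functional_uniform_path:
  assumes "\<And>t. F (uniform_path t) (vector [0, 6 / 5]) = K"
  shows "path_functional F 0 50 uniform_path = ereal (50 * K)"
proof -
  have "vector_derivative uniform_path (at t) = vector [0, 6 / 5]" for t
    using uniform_path_has_vector_derivative by (rule vector_derivative_at)
  then have F: "(\<lambda>t. F (uniform_path t) (vector_derivative uniform_path (at t))) = (\<lambda>t. K)"
    using assms by simp
  have "set_integrable lebesgue {0..50::real} (\<lambda>t. K)"
    by (rule absolutely_integrable_continuous_real) simp
  then show ?thesis unfolding path_functional_def F
    by (simp add: set_lebesgue_integral_eq_integral)
qed

text \<open>A competitor whose sine stays below \<open>1 / 2\<close> is handled by the calibration with equality on the uniform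
  path. Any other competitor makes a transition, which costs at least \<open>2 * (1 / 2 + 1) = 3\<close>; with the
  energy-0 calibration its action is at least \<open>60 * sqrt 2 + 3\<close>, hence at least 87, and the uniform path
  has action 86.\<close>

lemma EL_minimizer_uniform_path: "EL_minimizer 0 50 uniform_path"
  unfolding EL_minimizer_def
proof (intro allI impI; elim conjE)
  fix \<beta> :: "real \<Rightarrow> real^2"
  assume ac: "absolutely_continuous_on {0..50} \<beta>"
    and ends: "\<beta> 0 = uniform_path 0" "\<beta> 50 = uniform_path 50"
  let ?L = "\<lambda>t. lagrangian (\<beta> t) (vector_derivative \<beta> (at t))"
  have "path_functional lagrangian 0 50 uniform_path = ereal (50 * (43 / 25))"
    by (rule path_functional_uniform_path)
      (simp add: lagrangian_def norm_real_2 alpha_def potential_eq power_divide)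
  also have "\<dots> \<le> path_functional lagrangian 0 50 \<beta>"
  proof (rule path_functional_geI)
    assume int: "?L integrable_on {0..50}"
    show "50 * (43 / 25) \<le> integral {0..50} ?L"
    proof (cases "\<forall>t\<in>{0..50}. sin (\<beta> t $ 1) \<le> 1 / 2")
      case True
      then show ?thesis using calibration_slow[OF ac _ int] ends by simp
    next
      case False
      then obtain r where r: "0 \<le> r" "r \<le> 50" "1 / 2 < sin (\<beta> r $ 1)" by auto
      have int1: "?L integrable_on {0..r}" and int2: "?L integrable_on {r..50}"
        using int r by (auto intro: integrable_subinterval_real)
      have ac1: "absolutely_continuous_on {0..r} \<beta>" and ac2: "absolutely_continuous_on {r..50} \<beta>"
        using ac r by (auto intro: absolutely_continuous_on_subset)
      \<comment> \<open>The transition is charged only on the way out; on the way back \<open>\<sigma> = 0\<close> suffices.\<close>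
      have "sqrt 2 * (\<beta> r $ 2 - \<beta> 0 $ 2) + 2 * 1 * (sin (\<beta> r $ 1) - sin (\<beta> 0 $ 1)) \<le> integral {0..r} ?L"
        by (rule calibration_transition[OF ac1 r(1) int1]) simp
      moreover have "sqrt 2 * (\<beta> 50 $ 2 - \<beta> r $ 2) + 2 * 0 * (sin (\<beta> 50 $ 1) - sin (\<beta> r $ 1))
          \<le> integral {r..50} ?L"
        by (rule calibration_transition[OF ac2 r(2) int2]) simp
      moreover have "integral {0..r} ?L + integral {r..50} ?L = integral {0..50} ?L"
        using r int by (intro Henstock_Kurzweil_Integration.integral_combine) auto
      moreover have "7 / 5 \<le> sqrt 2" by (rule real_le_rsqrt) (simp add: power2_eq_square)
      ultimately show ?thesis using r(3) ends by (simp add: algebra_simps)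
    qed
  qed
  finally show "path_functional lagrangian 0 50 uniform_path \<le> path_functional lagrangian 0 50 \<beta>" .
qed

section \<open>A shorter path in the Jacobi metric\<close>

text \<open>The Jacobi metric is conformal to the Euclidean one. For \<open>E = - 7 / 25\<close> the factor is \<open>sqrt (18 / 25)\<close>
  where the sine is -1, and only \<open>2 / 5\<close> where it is 1.\<close>

lemma jacobi_integrand_eq:
  "jacobi_integrand E x v = sqrt (E * (2 + sin (x $ 1)) + 3 - 2 * (sin (x $ 1))\<^sup>2) * norm v"
proof -
  have "(E - potential (x $ 1)) * alpha (x $ 1) = E * (2 + sin (x $ 1)) + 3 - 2 * (sin (x $ 1))\<^sup>2"
    using alpha_pos[of "x $ 1"] by (simp add: potential_eq field_simps) (simp add: alpha_def algebra_simps)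
  then show ?thesis by (simp add: jacobi_integrand_def gnorm_def flip: real_sqrt_mult)
qed

text \<open>The path with unit speed through \<open>(- (pi / 2), 0)\<close>, \<open>(pi / 2, 0)\<close>, \<open>(pi / 2, 60)\<close>,
  \<open>(- (pi / 2), 60)\<close>. The formulas with minimum and maximum make its Lipschitz continuity evident.\<close>

definition detour :: "real \<Rightarrow> real^2" where
  "detour t = vector [min (t - pi / 2) (min (pi / 2) (3 * pi / 2 + 60 - t)), max 0 (min 60 (t - pi))]"

lemma detour_unit_speed:
  assumes "t \<notin> {0, pi, pi + 60, 2 * pi + 60}" "t \<in> {0..2 * pi + 60}"
  shows "norm (vector_derivative detour (at t)) = 1"
proof -
  have *: "norm (vector_derivative detour (at t)) = norm w"
    if "open S" "t \<in> S" "\<And>s. s \<in> S \<Longrightarrow> p + s *\<^sub>R w = detour s" for S p w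
  proof -
    have "((\<lambda>s. p + s *\<^sub>R w) has_vector_derivative w) (at t)"
      by (auto intro!: derivative_eq_intros)
    then have "(detour has_vector_derivative w) (at t)"
      using that by (rule has_vector_derivative_transform_within_open)
    then show ?thesis by (simp add: vector_derivative_at)
  qed
  have norm1: "norm (vector [1, 0] :: real^2) = 1" "norm (vector [0, 1] :: real^2) = 1"
      "norm (vector [-1, 0] :: real^2) = 1"
    by (simp_all add: norm_vec_def L2_set_def sum_2)
  consider "t \<in> {0<..<pi}" | "t \<in> {pi<..<pi + 60}" | "t \<in> {pi + 60<..<2 * pi + 60}"
    using assms by fastforce
  then show ?thesis
  proof cases
    case 1
    then show ?thesis
      using *[of "{0<..<pi}" "vector [- (pi / 2), 0]" "vector [1, 0]"] norm1
      by (auto simp: detour_def vec_eq_iff forall_2)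
  next
    case 2
    then show ?thesis
      using *[of "{pi<..<pi + 60}" "vector [pi / 2, - pi]" "vector [0, 1]"] norm1
      by (auto simp: detour_def vec_eq_iff forall_2)
  next
    case 3
    then show ?thesis
      using *[of "{pi + 60<..<2 * pi + 60}" "vector [3 * pi / 2 + 60, 60]" "vector [-1, 0]"] norm1
      by (auto simp: detour_def vec_eq_iff forall_2)
  qed
qed

lemma absolutely_continuous_on_detour: "absolutely_continuous_on S detour"
proof (rule absolutely_continuous_on_lipschitz_comp[OF absolutely_continuous_on_id])
  fix s t :: real
  have "\<bar>detour s $ 1 - detour t $ 1\<bar> \<le> \<bar>s - t\<bar>" "\<bar>detour s $ 2 - detour t $ 2\<bar> \<le> \<bar>s - t\<bar>"
    unfolding detour_def vector_2 by linarith+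
  then show "norm (detour s - detour t) \<le> 2 * norm (s - t)"
    using norm_le_l1_cart[of "detour s - detour t"] by (simp add: sum_2)
qed

lemma jacobi_length_detour: "path_functional (jacobi_integrand (- 7 / 25)) 0 (2 * pi + 60) detour \<le> 40"
proof -
  let ?J = "\<lambda>t. jacobi_integrand (- 7 / 25) (detour t) (vector_derivative detour (at t))"
  define u where "u = (\<lambda>t. sin (detour t $ 1))"
  define G where "G = (\<lambda>t. sqrt (- 7 / 25 * (2 + u t) + 3 - 2 * (u t)\<^sup>2))"
  have "continuous_on S u" for S
    unfolding u_def detour_def vector_2 by (intro continuous_intros)
  then have cG: "continuous_on S G" for S
    unfolding G_def by (intro continuous_intros)
  have JG: "?J t = G t" if "t \<in> {0..2 * pi + 60} - {0, pi, pi + 60, 2 * pi + 60}" for t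
    using that detour_unit_speed[of t] by (simp add: jacobi_integrand_eq G_def u_def)
  have neg: "negligible {0, pi, pi + 60, 2 * pi + 60}" by (rule negligible_finite) simp
  have int: "set_integrable lebesgue {0..2 * pi + 60} ?J"
    by (rule absolutely_integrable_spike[OF absolutely_integrable_continuous_real[OF cG] neg JG])
  have "integral {0..2 * pi + 60} ?J = integral {0..2 * pi + 60} G"
    by (rule integral_spike[OF neg JG, symmetric])
  also have "\<dots> = integral {0..pi} G + integral {pi..2 * pi + 60} G"
    using pi_ge_zero by (intro Henstock_Kurzweil_Integration.integral_combine[symmetric])
      (auto intro: integrable_continuous_real cG)
  also have "integral {pi..2 * pi + 60} G = integral {pi..pi + 60} G + integral {pi + 60..2 * pi + 60} G"
    using pi_ge_zero by (intro Henstock_Kurzweil_Integration.integral_combine[symmetric])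
      (auto intro: integrable_continuous_real cG)
  also have "integral {pi..pi + 60} G = integral {pi..pi + 60} (\<lambda>t. 2 / 5)"
  proof (rule integral_cong)
    fix t assume "t \<in> {pi..pi + 60}"
    then have "detour t $ 1 = pi / 2" by (simp add: detour_def min_def)
    then have "u t = 1" by (simp only: u_def sin_pi_half)
    then have "G t = sqrt ((2 / 5)\<^sup>2)" by (simp add: G_def power2_eq_square)
    then show "G t = 2 / 5" by (simp only: real_sqrt_abs)
  qed
  finally have split: "integral {0..2 * pi + 60} ?J =
      integral {0..pi} G + (24 + integral {pi + 60..2 * pi + 60} G)" by simp
  have G2: "G t \<le> 2" for t
  proof -
    have "- 1 \<le> u t" by (simp add: u_def)
    then have "- 7 / 25 * (2 + u t) \<le> 0" by simp
    moreover have "0 \<le> 2 * (u t)\<^sup>2" by simp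
    ultimately have "- 7 / 25 * (2 + u t) + 3 - 2 * (u t)\<^sup>2 \<le> 2\<^sup>2" by (simp only: power2_eq_square)
    then show ?thesis unfolding G_def by (intro real_le_lsqrt) auto
  qed
  have "integral {a..b} G \<le> integral {a..b} (\<lambda>t. 2)" for a b
    by (intro integral_le integrable_continuous_real cG) (auto simp: G2)
  from this[of 0 pi] this[of "pi + 60" "2 * pi + 60"]
  have "integral {0..2 * pi + 60} ?J \<le> 40"
    using split pi_less_4 by simp
  then show ?thesis
    using int by (simp add: path_functional_def set_lebesgue_integral_eq_integral)
qed

lemma jacobi_length_uniform_path:
  "48 \<le> path_functional (jacobi_integrand (- 7 / 25)) 0 50 uniform_path"
proof -
  have "path_functional (jacobi_integrand (- 7 / 25)) 0 50 uniform_path =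
      ereal (50 * (sqrt (18 / 25) * (6 / 5)))"
    by (rule path_functional_uniform_path)
      (simp add: jacobi_integrand_eq norm_vec_def L2_set_def sum_2)
  moreover have "4 / 5 \<le> sqrt (18 / 25)" by (rule real_le_rsqrt) (simp add: power2_eq_square)
  ultimately show ?thesis by simp
qed

theorem mainTheorem7:
  shows "\<exists>(\<gamma> :: real \<Rightarrow> real^2) a b E.
    a < b \<and> absolutely_continuous_on {a..b} \<gamma> \<and>
    EL_minimizer a b \<gamma> \<and>
    has_constant_energy a b \<gamma> E \<and> E > potential_max \<and>
    \<not> jacobi_minimizer E a b \<gamma>"
proof (intro exI conjI)
  show "(0::real) < 50" by simp
  show "absolutely_continuous_on {0..50} uniform_path"
  proof (rule absolutely_continuous_on_lipschitz_comp[OF absolutely_continuous_on_id])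
    fix s t
    have "uniform_path s - uniform_path t = (s - t) *\<^sub>R vector [0, 6 / 5]"
      by (simp add: uniform_path_def scaleR_left_diff_distrib)
    moreover have "norm (vector [0, 6 / 5] :: real^2) = 6 / 5"
      by (simp add: norm_vec_def L2_set_def sum_2)
    ultimately show "norm (uniform_path s - uniform_path t) \<le> 6 / 5 * norm (s - t)"
      by (simp only: norm_scaleR real_norm_def mult.commute)
  qed
  show "EL_minimizer 0 50 uniform_path" by (rule EL_minimizer_uniform_path)
  have "energy (uniform_path t) (vector [0, 6 / 5]) = - 7 / 25" for t
    by (simp add: energy_def norm_real_2 alpha_def potential_eq power_divide)
  then show "has_constant_energy 0 50 uniform_path (- 7 / 25)"
    unfolding has_constant_energy_def using uniform_path_has_vector_derivative by blast
  show "- 7 / 25 > potential_max" by (simp add: potential_max_eq potential_def)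
  show "\<not> jacobi_minimizer (- 7 / 25) 0 50 uniform_path"
  proof
    assume "jacobi_minimizer (- 7 / 25) 0 50 uniform_path"
    moreover have "\<not> pi \<le> 0" "\<not> 60 \<le> - pi" using pi_gt_zero by linarith+
    moreover from this have "detour 0 = uniform_path 0" "detour (2 * pi + 60) = uniform_path 50"
      using \<open>\<not> pi \<le> 0\<close> \<open>\<not> 60 \<le> - pi\<close>
      by (simp_all add: vec_eq_iff forall_2 detour_def min_def max_def)
    moreover have "0 < 2 * pi + 60" using pi_ge_zero by linarith
    ultimately have "path_functional (jacobi_integrand (- 7 / 25)) 0 50 uniform_path \<le>
        path_functional (jacobi_integrand (- 7 / 25)) 0 (2 * pi + 60) detour"
      unfolding jacobi_minimizer_def using absolutely_continuous_on_detour by blast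
    with jacobi_length_uniform_path jacobi_length_detour have "(48 :: ereal) \<le> 40"
      by (meson order_trans)
    then show False by simp
  qed
qed

end
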